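(* Let $\lambda\in R$ be such that $\Gamma(\lambda)$ is of Type A, and put $h_\lambda=\max\{m/2,n_\lambda\}$. If $\mathcal M_{loc,\lambda}$ is bounded from $L^p(\mathbb R^3)$ to $L^q(\mathbb R^3)$, then: (1) $(\frac1p,\frac1q)\in\overline{\Delta_0}$, the closure of $\Delta_0$; (2) if $c=0$, then $\frac{h_\lambda+1}{p}-\frac{h_\lambda+1}{q}-1\le0$; if $c\neq0$, then $\frac{h_\lambda+1}{p}-\frac1q-1\le0$.
   Context: Let $m\ge2$ be an integer, $c\in\mathbb R$, and let $\Phi\in\mathbb R[x_1,x_2]$ be a nonzero homogeneous polynomial of degree $m$. Factor $\Phi(x_1,x_2)=c_\Phi x_1^{\nu_1}x_2^{\nu_2}\prod_{h=1}^N(x_2-\lambda_hx_1)^{n_h}$ with distinct $\lambda_h\in\mathbb C\setminus\{0\}$ and $\nu_1+\nu_2+\sum_h n_h=m$. Standing assumption: $\nu_1,\nu_2$ and all $n_h$ are $<m$ (equivalently, $\Phi$ is not a constant multiple of the $m$-th power of a real linear form). Let $H\Phi=\partial_{11}\Phi\,\partial_{22}\Phi-(\partial_{12}\Phi)^2$ be the Hessian determinant. Write $H\Phi(x_1,x_2)=x_1^{\alpha_1}\prod_{\lambda\in R}(x_2-\lambda x_1)^{\omega_\lambda}Q(x_1,x_2)$, where $R\subset\mathbb R$ is the finite set of real $\lambda$ (possibly including $0$) with $H\Phi(1,\lambda)=0$, $\omega_\lambda\ge1$, and $Q\neq0$ away from the origin. For $\lambda\in R$ let $L_\lambda=\{x_2=\lambda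 x_1\}$. For a fixed sufficiently small $\epsilon>0$ and $\lambda\in R$, let $\Gamma(\lambda)\subset\mathbb R^2\setminus\{0\}$ be the set of $x$ whose angle with $(1,\lambda)$ or with $(-1,-\lambda)$ is $<\epsilon$ ($\epsilon$ so small that the sectors $\Gamma(\lambda)$ around the distinct lines in the zero set of $H\Phi$ are pairwise disjoint). $\Gamma(\lambda)$ is of Type A if $\Phi$ vanishes along $L_\lambda\setminus\{(0,0)\}$. In that case $n_\lambda$ is the integer with $\Phi(x_1,x_2)=(x_2-\lambda x_1)^{n_\lambda}P(x_1,x_2)$, where $P$ does not vanish along $L_\lambda\setminus\{(0,0)\}$. Let $U$ be a fixed sufficiently small neighborhood of the origin in $\mathbb R^2$, $S_\lambda=\{(x_1,x_2,\Phi(x_1,x_2)+c):(x_1,x_2)\in\Gamma(\lambda)\cap U\}$, $d\sigma_\lambda$ the surface measure on $S_\lambda$, and $$A_{t,\lambda}f(y)=\int_{S_\lambda}f(y-tx)\,d\sigma_\lambda(x),\qquad \mathcal M_{loc,\lambda}f(y)=\sup_{t\in[1,2]}|A_{t,\lambda}f(y)|,\quad y\in\mathbb R^3.$$ Boundedness from $L^p$ to $L^q$ means that $\|\mathcal M_{loc,\lambda}f\|_{L^q(\mathbb R^3)}\le C\|f\|_{L^p(\mathbb R^3)}$ for all $f$, with $C$ independent of $f$. $\Delta_0$ is the union of the interior of the quadrilateral with vertices $O_1=(0,0)$, $O_2=(2/3,2/3)$, $O_3=(2/3,1/3)$, $O_4=(3/5,1/5)$, and the segment $O_1O_2$ with $O_1$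 included and $O_2$ excluded. *)

theory Defs
  imports "HOL-Analysis.Analysis"
begin

definition homogeneous_poly :: "nat \<Rightarrow> (real^2 \<Rightarrow> real) \<Rightarrow> bool" where
  "homogeneous_poly m \<Phi> \<longleftrightarrow>
     (\<exists>a :: nat \<Rightarrow> real. \<forall>x. \<Phi> x = (\<Sum>i\<le>m. a i * (x $ 1) ^ (m - i) * (x $ 2) ^ i))"

definition pd :: "2 \<Rightarrow> (real^2 \<Rightarrow> real) \<Rightarrow> real^2 \<Rightarrow> real" where
  "pd i F x = deriv (\<lambda>s. F (x + s *\<^sub>R axis i 1)) 0"

definition hessian_det :: "(real^2 \<Rightarrow> real) \<Rightarrow> real^2 \<Rightarrow> real" where
  "hessian_det F x = pd 1 (pd 1 F) x * pd 2 (pd 2 F) x - (pd 1 (pd 2 F) x)\<^sup>2"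

text \<open>The set \<open>R\<close> of slopes of the non-vertical lines in the zero set of the Hessian determinant.\<close>

definition hessian_slopes :: "(real^2 \<Rightarrow> real) \<Rightarrow> real set" where
  "hessian_slopes \<Phi> = {l. hessian_det \<Phi> (vector [1, l]) = 0}"

definition line :: "real \<Rightarrow> (real^2) set" where
  "line l = {x. x $ 2 = l * x $ 1}"

definition angle :: "real^2 \<Rightarrow> real^2 \<Rightarrow> real" where
  "angle x v = arccos (x \<bullet> v / (norm x * norm v))"

definition sector :: "real \<Rightarrow> real^2 \<Rightarrow> (real^2) set" where
  "sector \<epsilon> v = {x. x \<noteq> 0 \<and> (angle x v < \<epsilon> \<or> angle x (- v) < \<epsilon>)}"

text \<open>The vectors \<open>v\<close>, \<open>w\<close> below span two different lines of the zero set of the Hessian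
  determinant; the line \<open>x $ 1 = 0\<close>, which has no slope, is included.\<close>

definition sectors_disjoint :: "(real^2 \<Rightarrow> real) \<Rightarrow> real \<Rightarrow> bool" where
  "sectors_disjoint \<Phi> \<epsilon> \<longleftrightarrow>
     (\<forall>v w. v \<noteq> 0 \<and> w \<noteq> 0 \<and> hessian_det \<Phi> v = 0 \<and> hessian_det \<Phi> w = 0 \<and> span {v} \<noteq> span {w}
        \<longrightarrow> sector \<epsilon> v \<inter> sector \<epsilon> w = {})"

definition Gamma_sector :: "real \<Rightarrow> real \<Rightarrow> (real^2) set" where
  "Gamma_sector \<epsilon> l = sector \<epsilon> (vector [1, l])"

definition type_A :: "(real^2 \<Rightarrow> real) \<Rightarrow> real \<Rightarrow> bool" where
  "type_A \<Phi> l \<longleftrightarrow> (\<forall>x \<in> line l - {0}. \<Phi> x = 0)"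

text \<open>\<open>vanishing_order \<Phi> l n\<close> says that \<open>n\<close> is the integer \<open>n\<^sub>\<lambda>\<close> for \<open>\<lambda> = l\<close>.\<close>

definition vanishing_order :: "(real^2 \<Rightarrow> real) \<Rightarrow> real \<Rightarrow> nat \<Rightarrow> bool" where
  "vanishing_order \<Phi> l n \<longleftrightarrow>
     (\<exists>P. real_polynomial_function P \<and>
          (\<forall>x. \<Phi> x = (x $ 2 - l * x $ 1) ^ n * P x) \<and>
          (\<forall>x \<in> line l - {0}. P x \<noteq> 0))"

text \<open>Surface measure on the graph of \<open>\<Phi> + c\<close> over \<open>D\<close>, as a measure on \<open>real^3\<close>:
  the image of \<open>sqrt (1 + \<bar>\<nabla>\<Phi>\<bar>\<^sup>2) dx\<close> on \<open>D\<close> under the graph map.\<close>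

definition graph_measure :: "(real^2 \<Rightarrow> real) \<Rightarrow> real \<Rightarrow> (real^2) set \<Rightarrow> (real^3) measure" where
  "graph_measure \<Phi> c D =
     distr (density lborel
              (\<lambda>x. indicator D x * ennreal (sqrt (1 + (pd 1 \<Phi> x)\<^sup>2 + (pd 2 \<Phi> x)\<^sup>2))))
       borel (\<lambda>x. vector [x $ 1, x $ 2, \<Phi> x + c])"

definition surface_average :: "(real^3) measure \<Rightarrow> real \<Rightarrow> (real^3 \<Rightarrow> real) \<Rightarrow> real^3 \<Rightarrow> real" where
  "surface_average \<sigma> t f y = (\<integral>x. f (y - t *\<^sub>R x) \<partial>\<sigma>)"

definition local_maximal :: "(real^3) measure \<Rightarrow> (real^3 \<Rightarrow> real) \<Rightarrow> real^3 \<Rightarrow> ennreal" where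
  "local_maximal \<sigma> f y = (SUP t\<in>{1..2}. ennreal \<bar>surface_average \<sigma> t f y\<bar>)"

definition epowr :: "ennreal \<Rightarrow> real \<Rightarrow> ennreal" where
  "epowr x a = (if x = \<infinity> then \<infinity> else ennreal (enn2real x powr a))"

text \<open>The \<open>L\<^sup>p\<close> norm of a nonnegative extended function, for \<open>1 \<le> p \<le> \<infinity>\<close>. A maximal function of a
  Borel function is Lebesgue measurable, being a supremum over a parameter of a jointly Borel
  function, but possibly not Borel. Neither clause is sensitive to this: integrals with respect
  to a measure and to its completion coincide, and an exceptional set
  in the second clause need only be contained in a null set.\<close>

definition Lp_norm :: "ennreal \<Rightarrow> (real^3 \<Rightarrow> ennreal) \<Rightarrow> ennreal" where
  "Lp_norm p g =
     (if p = \<infinity> then Inf {C. AE y in lborel. g y \<le> C}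
      else epowr (\<integral>\<^sup>+ y. epowr (g y) (enn2real p) \<partial>lborel) (1 / enn2real p))"

text \<open>Boundedness from \<open>L\<^sup>p\<close> to \<open>L\<^sup>q\<close>; elements of \<open>L\<^sup>p\<close> are given by Borel representatives, so that
  the averages over the (Lebesgue null) surfaces are defined.\<close>

definition maximal_bounded :: "(real^3) measure \<Rightarrow> ennreal \<Rightarrow> ennreal \<Rightarrow> bool" where
  "maximal_bounded \<sigma> p q \<longleftrightarrow>
     (\<exists>C::real. 0 \<le> C \<and>
        (\<forall>f \<in> borel_measurable borel. Lp_norm p (\<lambda>y. ennreal \<bar>f y\<bar>) < \<infinity> \<longrightarrow>
            Lp_norm q (local_maximal \<sigma> f) \<le> ennreal C * Lp_norm p (\<lambda>y. ennreal \<bar>f y\<bar>)))"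

definition recip :: "ennreal \<Rightarrow> real" where
  "recip p = enn2real (1 / p)"

definition Delta0 :: "(real \<times> real) set" where
  "Delta0 = interior (convex hull {(0, 0), (2/3, 2/3), (2/3, 1/3), (3/5, 1/5)})
            \<union> (closed_segment (0, 0) (2/3, 2/3) - {(2/3, 2/3)})"

end

theory Submission
  imports Defs
begin

text \<open>Every inequality in the conclusion comes from one family of test sets. If \<open>f\<close> is the indicator
of a set \<open>E\<close>, and if for every \<open>y\<close> in a set \<open>F\<close> some dilate \<open>t S\<close> of the surface with
\<open>1 \<le> t \<le> 2\<close> is such that a part of \<open>y - t S\<close> lying over an area at least \<open>A\<close> falls into \<open>E\<close>,
then the maximal function of \<open>f\<close> is at least \<open>A\<close> on \<open>F\<close>, and boundedness forces
\<open>A \<bar>F\<bar>\<^bsup>1/q\<^esup> \<le> C \<bar>E\<bar>\<^bsup>1/p\<^esup>\<close>. When \<open>A\<close>, \<open>\<bar>F\<bar>\<close>, \<open>\<bar>E\<bar>\<close> behave like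
\<open>\<delta>\<^sup>i\<close>, \<open>\<delta>\<^sup>j\<close>, \<open>\<delta>\<^sup>k\<close> as \<open>\<delta> \<rightarrow> 0\<close>, comparing exponents gives
\<open>k/p \<le> i + j/q\<close> (lemma \<open>test_family_exponents\<close>).

The closed quadrilateral is cut out by four half-planes, one for each of four classical examples:

  \<^item> \<open>1/q \<le> 1/p\<close>: \<open>E\<close> and \<open>F\<close> are cubes of side comparable to \<open>1/\<delta>\<close>, so that the average of the
    indicator is constant on \<open>F\<close> (\<open>large_ball_condition\<close>);
  \<^item> \<open>1/p \<le> 2/3\<close>: \<open>E\<close> is a cube of side comparable to \<open>\<delta>\<close>; the dilates of the surface sweep out a set
    \<open>F\<close> of positive measure, and near each of its points they meet \<open>E\<close> in area \<open>\<delta>\<^sup>2\<close>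
    (\<open>small_ball_condition\<close>);
  \<^item> \<open>1/q \<ge> 2/p - 1\<close>: the Knapp example, where \<open>E\<close> is a plate of size
    \<open>\<delta> \<times> \<delta> \<times> \<delta>\<^sup>2\<close> parallel to a tangent plane and \<open>F\<close> is a tube of radius \<open>\<delta>\<close>
    transversal to it (\<open>Knapp_condition\<close>);
  \<^item> \<open>1/q \<ge> 1/(3p)\<close>: \<open>E\<close> is the \<open>\<delta>\<close>-neighbourhood of the reflected surface and \<open>F\<close> a cube of side
    comparable to \<open>\<delta>\<close> (\<open>graph_condition\<close>).

The second and the third example need a point of the surface near which dilations really move the
surface, rather than let it slide along itself. For a homogeneous \<open>\<Phi>\<close> this asks that a certain combination
\<open>c + \<beta> \<Phi>\<close> with \<open>\<beta> \<noteq> 0\<close> does not vanish, which can be arranged by moving along a ray on which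
\<open>\<Phi> \<noteq> 0\<close>.

The remaining conditions measure how flat \<open>\<Phi>\<close> is. Close to the line \<open>x\<^sub>2 = \<lambda> x\<^sub>1\<close>
one has \<open>\<bar>\<Phi>\<bar> \<lesssim> \<delta>\<^sup>n\<close> on a strip of width \<open>\<delta>\<close>, with \<open>n\<close> the order of vanishing, and close to the
origin \<open>\<bar>\<Phi>\<bar> \<lesssim> \<delta>\<^sup>m\<close> on a square of side \<open>\<delta>\<close>. Taking for \<open>E\<close> the corresponding strip or square
thickened by \<open>\<delta>\<^sup>n\<close> or \<open>\<delta>\<^sup>m\<close> gives the two members of the maximum
\<open>h = max {m/2, n}\<close> (\<open>anisotropic_condition\<close>). If \<open>c \<noteq> 0\<close>, the dilations move this flat
piece vertically through an interval of length \<open>\<bar>c\<bar>\<close>, so that \<open>F\<close> is larger by a factor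
\<open>\<delta>\<^sup>-\<^sup>n\<close> or \<open>\<delta>\<^sup>-\<^sup>m\<close>; this is the difference between the two cases.\<close>

section \<open>Norms of test functions\<close>

lemma epowr_mono: "x \<le> y \<Longrightarrow> 0 \<le> a \<Longrightarrow> epowr x a \<le> epowr y a"
  by (auto simp: epowr_def top_unique enn2real_mono less_top intro!: ennreal_leI powr_mono2)

lemma epowr_ennreal: "0 \<le> x \<Longrightarrow> epowr (ennreal x) a = ennreal (x powr a)"
  by (simp add: epowr_def)

lemma exponent_finite:
  fixes p :: ennreal
  assumes "1 \<le> p" "p \<noteq> \<infinity>"
  shows "1 \<le> enn2real p" "recip p = 1 / enn2real p"
proof -
  obtain r where r: "p = ennreal r" "0 \<le> r" using assms by (cases p) auto
  have "ennreal 1 \<le> ennreal r" using assms r by simp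
  then have r1: "1 \<le> r" using r by (subst (asm) ennreal_le_iff) auto
  then have "1 / p = ennreal (1 / r)"
    using r divide_ennreal[of 1 r] by simp
  with r r1 show "1 \<le> enn2real p" "recip p = 1 / enn2real p"
    by (simp_all add: recip_def)
qed

lemma Lp_norm_indicator_le:
  assumes p: "1 \<le> p" and E: "E \<in> sets borel" and V: "emeasure lborel E \<le> ennreal V" "0 < V"
  shows "Lp_norm p (\<lambda>y. ennreal \<bar>indicator E y\<bar>) \<le> ennreal (V powr recip p)"
proof (cases "p = \<infinity>")
  case True
  have "Inf {C. AE y in lborel. ennreal \<bar>indicator E y\<bar> \<le> C} \<le> 1"
    by (rule Inf_lower) (auto simp: indicator_def)
  then show ?thesis using True V by (simp add: Lp_norm_def recip_def)
next
  case False
  note pf = exponent_finite[OF p False]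
  have "epowr (ennreal \<bar>indicator E y\<bar>) (enn2real p) = indicator E y" for y
    using pf by (auto simp: indicator_def epowr_def)
  then have "Lp_norm p (\<lambda>y. ennreal \<bar>indicator E y\<bar>) = epowr (emeasure lborel E) (recip p)"
    using False pf E by (simp add: Lp_norm_def)
  also have "\<dots> \<le> epowr (ennreal V) (recip p)"
    using V pf by (intro epowr_mono) auto
  finally show ?thesis using V by (simp add: epowr_ennreal)
qed

text \<open>Chebyshev's inequality. The nonnegative integral is a supremum over the simple functions below the
integrand and so is monotone even for non-measurable \<open>g\<close>; hence the
maximal function need not be known to be Borel.\<close>

lemma Lp_norm_ge:
  assumes q: "1 \<le> q" and F: "F \<in> sets borel" and W: "ennreal W \<le> emeasure lborel F" "0 < W"
    and A: "0 \<le> A" and g: "\<And>y. y \<in> F \<Longrightarrow> ennreal A \<le> g y"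
  shows "ennreal (A * W powr recip q) \<le> Lp_norm q g"
proof (cases "q = \<infinity>")
  case True
  have "ennreal A \<le> C" if "AE y in lborel. g y \<le> C" for C
  proof (rule ccontr)
    assume "\<not> ennreal A \<le> C"
    then have "AE y in lborel. y \<notin> F"
      using that g by (auto elim!: eventually_mono dest: order_trans)
    then have "emeasure lborel F = 0"
      using F by (simp add: AE_iff_measurable[of F])
    then show False using W by simp
  qed
  then show ?thesis using True W by (auto simp: Lp_norm_def recip_def intro!: Inf_greatest)
next
  case False
  note qf = exponent_finite[OF q False]
  have "ennreal (A powr enn2real q * W) = ennreal (A powr enn2real q) * ennreal W"
    by (simp add: ennreal_mult')
  also have "\<dots> \<le> ennreal (A powr enn2real q) * emeasure lborel F"
    by (intro mult_left_mono W) auto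
  also have "\<dots> = (\<integral>\<^sup>+ y. ennreal (A powr enn2real q) * indicator F y \<partial>lborel)"
    using F by (simp add: nn_integral_cmult_indicator)
  also have "\<dots> \<le> (\<integral>\<^sup>+ y. epowr (g y) (enn2real q) \<partial>lborel)"
    using qf A epowr_mono[OF g, of _ "enn2real q"]
    by (intro nn_integral_mono) (auto simp: indicator_def epowr_ennreal)
  finally have "epowr (ennreal (A powr enn2real q * W)) (recip q) \<le> Lp_norm q g"
    using False qf by (auto simp: Lp_norm_def intro!: epowr_mono)
  moreover have "(A powr enn2real q * W) powr recip q = A * W powr recip q"
    using A W qf by (simp add: powr_mult powr_powr)
  ultimately show ?thesis using W by (simp add: epowr_ennreal)
qed

text \<open>Otherwise \<open>K \<le> C \<delta> powr (r - s)\<close> with \<open>r - s > 0\<close>, and the right-hand side tends to \<open>0\<close> with \<open>\<delta>\<close>.\<close>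

lemma exponent_comparison:
  fixes C K r s \<delta>0 :: real
  assumes "0 < \<delta>0" "0 < K"
    and le: "\<And>\<delta>. 0 < \<delta> \<Longrightarrow> \<delta> < \<delta>0 \<Longrightarrow> K * \<delta> powr s \<le> C * \<delta> powr r"
  shows "r \<le> s"
proof (rule ccontr)
  assume "\<not> r \<le> s"
  then have e: "0 < r - s" by simp
  \<comment> \<open>the value that \<open>\<delta> powr (r - s)\<close> must not exceed for the contradiction \<open>K < K\<close>\<close>
  define x where "x = K / (\<bar>C\<bar> + 1)"
  have x: "0 < x" using assms by (simp add: x_def)
  define \<delta> where "\<delta> = min (\<delta>0 / 2) (x powr (1 / (r - s)))"
  have \<delta>: "0 < \<delta>" "\<delta> < \<delta>0" using assms x by (auto simp: \<delta>_def)
  have "\<delta> powr (r - s) \<le> (x powr (1 / (r - s))) powr (r - s)"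
    using e \<delta> by (intro powr_mono2) (auto simp: \<delta>_def)
  also have "\<dots> = x" using e x by (simp add: powr_powr)
  finally have small: "\<delta> powr (r - s) \<le> x" .
  have "K * \<delta> powr s \<le> (C * \<delta> powr (r - s)) * \<delta> powr s"
    using le[OF \<delta>] by (simp add: mult.assoc flip: powr_add)
  then have "K \<le> C * \<delta> powr (r - s)" using \<delta> by simp
  also have "\<dots> \<le> \<bar>C\<bar> * x"
    using small by (intro mult_mono) auto
  also have "\<dots> < K" using assms by (simp add: x_def field_simps)
  finally show False by simp
qed

section \<open>Polynomials on the plane\<close>

lemma polynomial_continuous_on: "real_polynomial_function f \<Longrightarrow> continuous_on S f"
  by (simp add: continuous_on_polymonial_function real_polynomial_function_eq)

text \<open>The partial derivatives of a polynomial are polynomials, by induction with the product rule; all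
that the surface measure needs of them is that its density is Borel and locally bounded.\<close>

lemma pd_polynomial:
  assumes "real_polynomial_function F"
  shows "continuous_on S (pd i F)"
proof -
  have "\<exists>G. real_polynomial_function G \<and>
          (\<forall>x. ((\<lambda>s. F (x + s *\<^sub>R axis i 1)) has_real_derivative G x) (at 0))"
    using assms
  proof induction
    case (linear f)
    then interpret bounded_linear f .
    show ?case
      by (rule exI[of _ "\<lambda>x. f (axis i 1)"]) (auto simp: add scaleR intro!: derivative_eq_intros)
  next
    case (const c)
    show ?case by (rule exI[of _ "\<lambda>x. 0"]) auto
  next
    case (add f g)
    then obtain f' g' where
      "real_polynomial_function f'" "\<And>x. ((\<lambda>s. f (x + s *\<^sub>R axis i 1)) has_real_derivative f' x) (at 0)"
      "real_polynomial_function g'" "\<And>x. ((\<lambda>s. g (x + s *\<^sub>R axis i 1)) has_real_derivative g' x) (at 0)"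
      by blast
    then show ?case
      by (intro exI[of _ "\<lambda>x. f' x + g' x"]) (auto intro: DERIV_add)
  next
    case (mult f g)
    then obtain f' g' where d:
      "real_polynomial_function f'" "\<And>x. ((\<lambda>s. f (x + s *\<^sub>R axis i 1)) has_real_derivative f' x) (at 0)"
      "real_polynomial_function g'" "\<And>x. ((\<lambda>s. g (x + s *\<^sub>R axis i 1)) has_real_derivative g' x) (at 0)"
      by blast
    show ?case
      using DERIV_mult[OF d(2) d(4)] d(1,3) mult(1,2)
      by (intro exI[of _ "\<lambda>x. f' x * g x + g' x * f x"]) auto
  qed
  then obtain G where "real_polynomial_function G" "pd i F = G"
    unfolding pd_def fun_eq_iff by (blast intro: DERIV_imp_deriv)
  then show ?thesis by (simp add: polynomial_continuous_on)
qed

lemma norm_le_components2: "norm (x :: real^2) \<le> \<bar>x $ 1\<bar> + \<bar>x $ 2\<bar>"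
  using norm_le_l1_cart[of x] by (simp add: sum_2)

lemma polynomial_bounded:
  assumes "real_polynomial_function (f :: real^2 \<Rightarrow> real)"
  obtains B where "0 < B" "\<And>x. norm x \<le> r \<Longrightarrow> \<bar>f x\<bar> \<le> B"
proof -
  have "bounded (f ` cball 0 r)"
    by (intro compact_imp_bounded compact_continuous_image polynomial_continuous_on assms) auto
  then show ?thesis using that unfolding bounded_pos by auto
qed

lemma polynomial_Lipschitz:
  assumes "real_polynomial_function (f :: real^2 \<Rightarrow> real)"
  shows "\<exists>L>0. \<forall>x y. norm x \<le> r \<and> norm y \<le> r \<longrightarrow> \<bar>f x - f y\<bar> \<le> L * norm (x - y)"
  using assms
proof induction
  case (linear f)
  then interpret bounded_linear f .
  from pos_bounded obtain K where "0 < K" "\<And>x. \<bar>f x\<bar> \<le> norm x * K" by auto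
  then show ?case by (intro exI[of _ K]) (auto simp: mult.commute simp flip: diff)
next
  case (const c)
  show ?case by (intro exI[of _ 1]) auto
next
  case (add f g)
  then obtain K L where *: "0 < K" "0 < L"
    "\<And>x y. norm x \<le> r \<Longrightarrow> norm y \<le> r \<Longrightarrow> \<bar>f x - f y\<bar> \<le> K * norm (x - y)"
    "\<And>x y. norm x \<le> r \<Longrightarrow> norm y \<le> r \<Longrightarrow> \<bar>g x - g y\<bar> \<le> L * norm (x - y)" by blast
  show ?case
  proof (intro exI[of _ "K + L"] conjI allI impI)
    fix x y :: "real^2" assume "norm x \<le> r \<and> norm y \<le> r"
    with *(3,4)[of x y] show "\<bar>f x + g x - (f y + g y)\<bar> \<le> (K + L) * norm (x - y)"
      unfolding distrib_right by linarith
  qed (use * in auto)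
next
  case (mult f g)
  then obtain K L where *: "0 < K" "0 < L"
    "\<And>x y. norm x \<le> r \<Longrightarrow> norm y \<le> r \<Longrightarrow> \<bar>f x - f y\<bar> \<le> K * norm (x - y)"
    "\<And>x y. norm x \<le> r \<Longrightarrow> norm y \<le> r \<Longrightarrow> \<bar>g x - g y\<bar> \<le> L * norm (x - y)" by blast
  obtain A where A: "0 < A" "\<And>x. norm x \<le> r \<Longrightarrow> \<bar>f x\<bar> \<le> A" using polynomial_bounded[OF mult(1)] by metis
  obtain B where B: "0 < B" "\<And>x. norm x \<le> r \<Longrightarrow> \<bar>g x\<bar> \<le> B" using polynomial_bounded[OF mult(2)] by metis
  show ?case
  proof (intro exI[of _ "A * L + K * B"] conjI allI impI)
    fix x y :: "real^2" assume xy: "norm x \<le> r \<and> norm y \<le> r"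
    have "\<bar>f x * g x - f y * g y\<bar> = \<bar>f x * (g x - g y) + (f x - f y) * g y\<bar>" by (simp add: algebra_simps)
    also have "\<dots> \<le> \<bar>f x\<bar> * \<bar>g x - g y\<bar> + \<bar>f x - f y\<bar> * \<bar>g y\<bar>"
      by (metis abs_mult abs_triangle_ineq)
    also have "\<dots> \<le> A * (L * norm (x - y)) + (K * norm (x - y)) * B"
      using xy *(3,4)[of x y] A(2)[of x] B(2)[of y] A(1) B(1) *(1,2) by (intro add_mono mult_mono) auto
    finally show "\<bar>f x * g x - f y * g y\<bar> \<le> (A * L + K * B) * norm (x - y)" by (simp add: algebra_simps)
  qed (use * A B in \<open>auto intro!: add_pos_pos\<close>)
qed

text \<open>The constant \<open>M\<close> replaces a bound on second derivatives. In the product case the error of \<open>f g\<close>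
is split as (error of \<open>f\<close>) \<open>g x0\<close> \<open>+\<close> \<open>f x\<close> (error of \<open>g\<close>) \<open>+\<close> \<open>(f x - f x0) L (x - x0)\<close>, and the
last term is quadratic by the Lipschitz bound.\<close>

lemma polynomial_Taylor2:
  assumes "real_polynomial_function (f :: real^2 \<Rightarrow> real)"
  shows "\<exists>L M. bounded_linear L \<and> (f has_derivative L) (at x0) \<and> 0 < M \<and>
    (\<forall>x. norm (x - x0) \<le> 1 \<longrightarrow> \<bar>f x - f x0 - L (x - x0)\<bar> \<le> M * (norm (x - x0))\<^sup>2)"
  using assms
proof induction
  case (linear f)
  then interpret bounded_linear f .
  show ?case
    using bounded_linear_axioms bounded_linear_imp_has_derivative[OF bounded_linear_axioms]
    by (intro exI[of _ f] exI[of _ "1::real"]) (auto simp flip: diff)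
next
  case (const c)
  show ?case by (intro exI[of _ "\<lambda>x. 0"] exI[of _ "1::real"]) auto
next
  case (add f g)
  then obtain K M L N where *: "bounded_linear K" "bounded_linear L" "0 < M" "0 < N"
    "(f has_derivative K) (at x0)" "(g has_derivative L) (at x0)"
    "\<And>x. norm (x - x0) \<le> 1 \<Longrightarrow> \<bar>f x - f x0 - K (x - x0)\<bar> \<le> M * (norm (x - x0))\<^sup>2"
    "\<And>x. norm (x - x0) \<le> 1 \<Longrightarrow> \<bar>g x - g x0 - L (x - x0)\<bar> \<le> N * (norm (x - x0))\<^sup>2" by blast
  show ?case
  proof (intro exI[of _ "\<lambda>x. K x + L x"] exI[of _ "M + N"] conjI allI impI)
    fix x assume "norm (x - x0) \<le> 1"
    with *(7,8)[of x] show "\<bar>f x + g x - (f x0 + g x0) - (K (x - x0) + L (x - x0))\<bar> \<le> (M + N) * (norm (x - x0))\<^sup>2"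
      unfolding distrib_right by linarith
  qed (use * in \<open>auto intro: bounded_linear_add has_derivative_add\<close>)
next
  case (mult f g)
  then obtain K M L N where *: "bounded_linear K" "bounded_linear L" "0 < M" "0 < N"
    "(f has_derivative K) (at x0)" "(g has_derivative L) (at x0)"
    "\<And>x. norm (x - x0) \<le> 1 \<Longrightarrow> \<bar>f x - f x0 - K (x - x0)\<bar> \<le> M * (norm (x - x0))\<^sup>2"
    "\<And>x. norm (x - x0) \<le> 1 \<Longrightarrow> \<bar>g x - g x0 - L (x - x0)\<bar> \<le> N * (norm (x - x0))\<^sup>2" by blast
  define r where "r = norm x0 + 1"
  obtain A where A: "0 < A" "\<And>x. norm x \<le> r \<Longrightarrow> \<bar>f x\<bar> \<le> A" using polynomial_bounded[OF mult(1)] by metis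
  obtain P where P: "0 < P" "\<And>x y. norm x \<le> r \<Longrightarrow> norm y \<le> r \<Longrightarrow> \<bar>f x - f y\<bar> \<le> P * norm (x - y)"
    using polynomial_Lipschitz[OF mult(1)] by blast
  obtain Q where Q: "0 < Q" "\<And>x. \<bar>L x\<bar> \<le> norm x * Q"
    using bounded_linear.pos_bounded[OF *(2)] by auto
  define C where "C = M * \<bar>g x0\<bar> + A * N + P * Q"
  show ?case
  proof (intro exI[of _ "\<lambda>x. g x0 * K x + f x0 * L x"] exI[of _ C] conjI allI impI)
    show "0 < C" using A P Q * by (auto simp: C_def intro!: add_nonneg_pos add_nonneg_nonneg)
    fix x assume x: "norm (x - x0) \<le> 1"
    let ?d = "norm (x - x0)"
    have nx: "norm x \<le> r" "norm x0 \<le> r" using x norm_triangle_sub[of x x0] by (auto simp: r_def)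
    have "f x * g x - f x0 * g x0 - (g x0 * K (x - x0) + f x0 * L (x - x0))
      = (f x - f x0 - K (x - x0)) * g x0 + f x * (g x - g x0 - L (x - x0)) + (f x - f x0) * L (x - x0)"
      by (simp add: algebra_simps)
    also have "\<bar>\<dots>\<bar> \<le> \<bar>f x - f x0 - K (x - x0)\<bar> * \<bar>g x0\<bar> + \<bar>f x\<bar> * \<bar>g x - g x0 - L (x - x0)\<bar> +
        \<bar>f x - f x0\<bar> * \<bar>L (x - x0)\<bar>"
      unfolding abs_mult[symmetric] by linarith
    also have "\<dots> \<le> (M * ?d\<^sup>2) * \<bar>g x0\<bar> + A * (N * ?d\<^sup>2) + (P * ?d) * (?d * Q)"
      using *(3,4,7,8) x nx A P Q by (intro add_mono mult_mono) auto
    also have "\<dots> = C * ?d\<^sup>2" by (simp add: C_def algebra_simps power2_eq_square)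
    finally show "\<bar>f x * g x - f x0 * g x0 - (g x0 * K (x - x0) + f x0 * L (x - x0))\<bar> \<le> C * ?d\<^sup>2" .
    next
    show "((\<lambda>x. f x * g x) has_derivative (\<lambda>x. g x0 * K x + f x0 * L x)) (at x0)"
      using has_derivative_mult[OF *(5,6)] by (simp add: algebra_simps)
  qed (use * in \<open>auto intro!: bounded_linear_add bounded_linear_const_mult\<close>)
qed

lemma homogeneous_poly_scale:
  assumes "homogeneous_poly m \<Phi>"
  shows "\<Phi> (s *\<^sub>R x) = s ^ m * \<Phi> x"
proof -
  obtain a where a: "\<And>x. \<Phi> x = (\<Sum>i\<le>m. a i * (x $ 1) ^ (m - i) * (x $ 2) ^ i)"
    using assms by (auto simp: homogeneous_poly_def)
  have "a i * (s * x $ 1) ^ (m - i) * (s * x $ 2) ^ i = s ^ m * (a i * (x $ 1) ^ (m - i) * (x $ 2) ^ i)"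
    if "i \<le> m" for i
    using that power_add[of s "m - i" i] by (simp add: power_mult_distrib)
  then show ?thesis
    unfolding a sum_distrib_left by (intro sum.cong refl) (simp only: vector_scaleR_component real_scaleR_def atMost_iff)
qed

lemma homogeneous_poly_polynomial:
  assumes "homogeneous_poly m \<Phi>"
  shows "real_polynomial_function \<Phi>"
proof -
  obtain a where a: "\<Phi> = (\<lambda>x. \<Sum>i\<le>m. a i * (x $ 1) ^ (m - i) * (x $ 2) ^ i)"
    using assms by (auto simp: homogeneous_poly_def)
  show ?thesis
    unfolding a by (intro real_polynomial_function_sum real_polynomial_function_power
        real_polynomial_function.intros bounded_linear_vec_nth finite_atMost)
qed

section \<open>Volumes of boxes, tubes and thickened graphs\<close>

text \<open>The set is the image of a box under the inverse matrix.\<close>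

lemma parallelepiped_measure:
  fixes M :: "real^'n::{finite,wellorder}^'n::_"
  assumes "det M \<noteq> 0"
  shows "{z. M *v z \<in> cbox a b} \<in> sets borel"
    and "emeasure lborel {z. M *v z \<in> cbox a b} = ennreal (measure lborel (cbox a b) / \<bar>det M\<bar>)"
proof -
  let ?S = "{z. M *v z \<in> cbox a b}"
  have cont: "continuous_on UNIV (\<lambda>z. M *v z)"
    by (intro linear_continuous_on linear_linear[THEN iffD1]) auto
  have closed: "closed ?S"
    using continuous_closed_vimage[OF closed_cbox, of "\<lambda>z. M *v z"] cont
    by (auto simp: vimage_def continuous_on_eq_continuous_at)
  then show b: "?S \<in> sets borel" by simp
  obtain N where N: "M ** N = mat 1" "N ** M = mat 1"
    using assms by (auto simp: invertible_def simp flip: invertible_det_nz)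
  have S: "?S = (\<lambda>w. N *v w) ` cbox a b"
  proof (intro set_eqI iffI)
    fix z assume "z \<in> ?S"
    then show "z \<in> (\<lambda>w. N *v w) ` cbox a b"
      using N by (intro image_eqI[of _ _ "M *v z"]) (auto simp: matrix_vector_mul_assoc N)
  qed (use N in \<open>auto simp: matrix_vector_mul_assoc N\<close>)
  have d: "det (N) = 1 / det M"
    using det_mul[of M N] assms by (simp add: N field_simps)
  have lm: "?S \<in> lmeasurable" unfolding S by (intro measurable_linear_image) auto
  have "measure lebesgue ?S = measure lborel (cbox a b) / \<bar>det M\<bar>"
    unfolding S by (subst measure_linear_image) (auto simp: d)
  then show "emeasure lborel ?S = ennreal (measure lborel (cbox a b) / \<bar>det M\<bar>)"
    using lm b emeasure_eq_measure2[OF lm] by simp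
qed

lemma prod_UNIV3: "prod f (UNIV :: 3 set) = f 1 * f 2 * f 3"
  unfolding UNIV_3 by (simp add: mult.assoc)

lemma shear_box3:
  fixes a b1 b2 c1 c2 c3 r1 r2 r3 :: real
  assumes "0 \<le> r1" "0 \<le> r2" "0 \<le> r3"
  defines "S \<equiv> {z :: real^3. \<bar>z $ 1 - c1\<bar> \<le> r1 \<and> \<bar>z $ 2 - a * z $ 1 - c2\<bar> \<le> r2 \<and>
      \<bar>z $ 3 - b1 * z $ 1 - b2 * z $ 2 - c3\<bar> \<le> r3}"
  shows "S \<in> sets borel" "emeasure lborel S = ennreal (8 * r1 * r2 * r3)"
proof -
  define M :: "real^3^3" where "M = vector [vector [1, 0, 0], vector [- a, 1, 0], vector [- b1, - b2, 1]]"
  let ?lo = "vector [c1 - r1, c2 - r2, c3 - r3] :: real^3"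
  let ?hi = "vector [c1 + r1, c2 + r2, c3 + r3] :: real^3"
  have S: "S = {z. M *v z \<in> cbox ?lo ?hi}"
    by (auto simp: S_def M_def mem_box_cart forall_3 matrix_vector_mult_def sum_3 abs_le_iff)
  have d: "det M = 1" by (simp add: M_def det_3)
  have "cbox ?lo ?hi \<noteq> {}" using assms by (simp add: interval_ne_empty_cart forall_3)
  then have m: "measure lborel (cbox ?lo ?hi) = 8 * r1 * r2 * r3"
    by (simp add: content_cbox_cart prod_UNIV3)
  show "S \<in> sets borel" "emeasure lborel S = ennreal (8 * r1 * r2 * r3)"
    using parallelepiped_measure[of M ?lo ?hi] by (simp_all add: S d m)
qed

lemma box3:
  fixes c1 c2 c3 r1 r2 r3 :: real
  assumes "0 \<le> r1" "0 \<le> r2" "0 \<le> r3"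
  shows "{z :: real^3. \<bar>z $ 1 - c1\<bar> \<le> r1 \<and> \<bar>z $ 2 - c2\<bar> \<le> r2 \<and> \<bar>z $ 3 - c3\<bar> \<le> r3} \<in> sets borel"
    "emeasure lborel {z :: real^3. \<bar>z $ 1 - c1\<bar> \<le> r1 \<and> \<bar>z $ 2 - c2\<bar> \<le> r2 \<and> \<bar>z $ 3 - c3\<bar> \<le> r3}
      = ennreal (8 * r1 * r2 * r3)"
  using shear_box3[OF assms, of c1 0 c2 0 0 c3] by simp_all

lemma shear_box2:
  fixes a c1 c2 r1 r2 :: real
  assumes "0 \<le> r1" "0 \<le> r2"
  defines "S \<equiv> {x :: real^2. \<bar>x $ 1 - c1\<bar> \<le> r1 \<and> \<bar>x $ 2 - a * x $ 1 - c2\<bar> \<le> r2}"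
  shows "S \<in> sets borel" "emeasure lborel S = ennreal (4 * r1 * r2)"
proof -
  define M :: "real^2^2" where "M = vector [vector [1, 0], vector [- a, 1]]"
  let ?lo = "vector [c1 - r1, c2 - r2] :: real^2"
  let ?hi = "vector [c1 + r1, c2 + r2] :: real^2"
  have S: "S = {z. M *v z \<in> cbox ?lo ?hi}"
    by (auto simp: S_def M_def mem_box_cart forall_2 matrix_vector_mult_def sum_2 abs_le_iff)
  have d: "det M = 1" by (simp add: M_def det_2)
  have "cbox ?lo ?hi \<noteq> {}" using assms by (simp add: interval_ne_empty_cart forall_2)
  then have m: "measure lborel (cbox ?lo ?hi) = 4 * r1 * r2"
    by (simp add: content_cbox_cart UNIV_2)
  show "S \<in> sets borel" "emeasure lborel S = ennreal (4 * r1 * r2)"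
    using parallelepiped_measure[of M ?lo ?hi] by (simp_all add: S d m)
qed

lemma box2:
  fixes c1 c2 r1 r2 :: real
  assumes "0 \<le> r1" "0 \<le> r2"
  shows "{x :: real^2. \<bar>x $ 1 - c1\<bar> \<le> r1 \<and> \<bar>x $ 2 - c2\<bar> \<le> r2} \<in> sets borel"
    "emeasure lborel {x :: real^2. \<bar>x $ 1 - c1\<bar> \<le> r1 \<and> \<bar>x $ 2 - c2\<bar> \<le> r2} = ennreal (4 * r1 * r2)"
  using shear_box2[OF assms, of c1 0 c2] by simp_all

text \<open>The tube \<open>{t (x1, x2, *) + (u1, u2, *) | 1 \<le> t \<le> 2, \<bar>u1\<bar> \<le> r, \<bar>u2\<bar> \<le> r}\<close> whose third coordinate
is fixed by \<open>z\<^sub>3 = g1 z\<^sub>1 + g2 z\<^sub>2 + \<kappa> t\<close>. The function \<open>h\<close> recovers the parameter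
\<open>t\<close> from a point, and \<open>\<kappa>\<close> is the determinant of the parametrisation.\<close>

lemma tube_measure:
  fixes x1 x2 g1 g2 \<kappa> r :: real
  assumes "0 \<le> r" "\<kappa> \<noteq> 0"
  defines "h \<equiv> \<lambda>z :: real^3. (z $ 3 - g1 * z $ 1 - g2 * z $ 2) / \<kappa>"
  defines "S \<equiv> {z. \<bar>z $ 1 - h z * x1\<bar> \<le> r \<and> \<bar>z $ 2 - h z * x2\<bar> \<le> r \<and> 1 \<le> h z \<and> h z \<le> 2}"
  shows "S \<in> sets borel" "emeasure lborel S = ennreal (4 * r\<^sup>2 * \<bar>\<kappa>\<bar>)"
proof -
  define M :: "real^3^3" where
    "M = vector [vector [1 + g1 * x1 / \<kappa>, g2 * x1 / \<kappa>, - x1 / \<kappa>],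
                 vector [g1 * x2 / \<kappa>, 1 + g2 * x2 / \<kappa>, - x2 / \<kappa>],
                 vector [- g1 / \<kappa>, - g2 / \<kappa>, 1 / \<kappa>]]"
  let ?lo = "vector [- r, - r, 1] :: real^3"
  let ?hi = "vector [r, r, 2] :: real^3"
  have comp: "(M *v z) $ 1 = z $ 1 - h z * x1" "(M *v z) $ 2 = z $ 2 - h z * x2" "(M *v z) $ 3 = h z" for z
    using assms(2) by (simp_all add: M_def h_def matrix_vector_mult_def sum_3 field_simps)
  have S: "S = {z. M *v z \<in> cbox ?lo ?hi}"
    by (auto simp: S_def mem_box_cart forall_3 comp abs_le_iff)
  have d: "det M = 1 / \<kappa>"
    using assms(2) by (simp add: M_def det_3 field_simps)
  have "cbox ?lo ?hi \<noteq> {}" using assms by (simp add: interval_ne_empty_cart forall_3)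
  then have m: "measure lborel (cbox ?lo ?hi) = 4 * r\<^sup>2"
    by (simp add: content_cbox_cart prod_UNIV3 power2_eq_square)
  show "S \<in> sets borel" "emeasure lborel S = ennreal (4 * r\<^sup>2 * \<bar>\<kappa>\<bar>)"
    using parallelepiped_measure[of M ?lo ?hi] assms(2) by (simp_all add: S d m)
qed

text \<open>The set is contained in the image of a box under \<open>z \<mapsto> z + f(z\<^sub>1, z\<^sub>2) e\<^sub>3\<close>, a nonlinear
shear whose Jacobian determinant is \<open>1\<close>.\<close>

lemma graph_neighbourhood_measure:
  fixes f :: "real^2 \<Rightarrow> real"
  assumes f: "real_polynomial_function f" and r: "0 \<le> r1" "0 \<le> r2" "0 \<le> r3"
  defines "S \<equiv> {z :: real^3. \<bar>z $ 1\<bar> \<le> r1 \<and> \<bar>z $ 2\<bar> \<le> r2 \<and> \<bar>z $ 3 - f (vector [z $ 1, z $ 2])\<bar> \<le> r3}"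
  shows "S \<in> sets borel" "emeasure lborel S \<le> ennreal (8 * r1 * r2 * r3)"
proof -
  define u where "u = (\<lambda>z :: real^3. vector [z $ 1, z $ 2] :: real^2)"
  have ueq: "u z = z $ 1 *\<^sub>R axis 1 1 + z $ 2 *\<^sub>R axis 2 1" for z
    by (simp add: u_def vec_eq_iff forall_2 axis_def)
  have u: "bounded_linear u"
    unfolding ueq by (intro bounded_linear_add bounded_linear_scaleR_const bounded_linear_vec_nth)
  have fu: "continuous_on UNIV (\<lambda>z. f (u z))"
    using continuous_on_compose[OF linear_continuous_on[OF u] polynomial_continuous_on[OF f]]
    by (simp add: o_def)
  have "closed S"
    unfolding S_def
    using fu[unfolded u_def] by (intro closed_Collect_conj closed_Collect_le continuous_intros)
  then show b: "S \<in> sets borel" by simp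
  define Q where "Q = {z :: real^3. \<bar>z $ 1 - 0\<bar> \<le> r1 \<and> \<bar>z $ 2 - 0\<bar> \<le> r2 \<and> \<bar>z $ 3 - 0\<bar> \<le> r3}"
  note Q = box3[OF r, of 0 0 0, folded Q_def]
  then have Ql: "Q \<in> lmeasurable" "measure lebesgue Q = 8 * r1 * r2 * r3"
    using r by (auto simp: fmeasurable_def measure_def)
  define g where "g = (\<lambda>z :: real^3. z + f (u z) *\<^sub>R axis 3 1)"
  have ug: "u (z + s *\<^sub>R axis 3 1) = u z" for z s
    by (simp add: u_def axis_def)
  have "z \<in> g ` Q" if "z \<in> S" for z
    using that
    by (intro image_eqI[of _ _ "z + (- f (u z)) *\<^sub>R axis 3 1"])
      (simp_all only: g_def ug, simp_all add: Q_def S_def u_def axis_def)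
  then have SQ: "S \<subseteq> g ` Q" by blast
  have "\<exists>L. bounded_linear L \<and> (f has_derivative L) (at x)" for x
    using polynomial_Taylor2[OF f] by blast
  then obtain L where L: "\<And>x. (f has_derivative L x) (at x)" "\<And>x. bounded_linear (L x)" by metis
  define g' where "g' = (\<lambda>z h :: real^3. h + L (u z) (u h) *\<^sub>R axis 3 1)"
  have der: "(g has_derivative g' z) (at z within Q)" for z
  proof -
    have "((\<lambda>z. f (u z)) has_derivative (\<lambda>h. L (u z) (u h))) (at z)"
      using has_derivative_compose[OF bounded_linear_imp_has_derivative[OF u] L(1)] .
    then have "(g has_derivative g' z) (at z)"
      unfolding g_def g'_def by (auto intro!: derivative_eq_intros)
    then show ?thesis by (rule has_derivative_at_withinI)
  qed
  have u3: "u (axis 3 1) = 0" by (simp add: u_def vec_eq_iff forall_2 axis_def)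
  have det: "det (matrix (g' z)) = 1" for z
    using linear_simps(3)[OF L(2)[of "u z"]]
    by (simp add: det_3 matrix_def g'_def u3) (simp add: axis_def)
  have "g ` Q \<in> lmeasurable" "measure lebesgue (g ` Q) \<le> 1 * measure lebesgue Q"
    using Ql(1)
    by (intro measurable_bounded_differentiable_image[of Q g g' 1]
        measure_bounded_differentiable_image[of Q g g' 1] der; simp add: det lmeasurable_iff_integrable_on)+
  then have "emeasure lebesgue (g ` Q) \<le> ennreal (8 * r1 * r2 * r3)"
    using Ql(2) by (simp add: emeasure_eq_measure2 ennreal_leI)
  moreover have "emeasure lborel S \<le> emeasure lebesgue (g ` Q)"
    using emeasure_mono[OF SQ, of lebesgue] b \<open>g ` Q \<in> lmeasurable\<close>
    by (simp add: fmeasurable_def)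
  ultimately show "emeasure lborel S \<le> ennreal (8 * r1 * r2 * r3)" by (rule order_trans[rotated])
qed

section \<open>Averages over a graph and families of test sets\<close>

lemma vector3_axis: "(vector [a, b, d] :: real^3) = a *\<^sub>R axis 1 1 + b *\<^sub>R axis 2 1 + d *\<^sub>R axis 3 1"
  by (simp add: vec_eq_iff forall_3 axis_def)

lemma continuous_on_vector3:
  assumes "continuous_on S a" "continuous_on S b" "continuous_on S d"
  shows "continuous_on S (\<lambda>x. vector [a x, b x, d x] :: real^3)"
  unfolding vector3_axis by (intro continuous_intros assms)

text \<open>The density of the surface measure is at least \<open>1\<close>, so a piece of the surface has at least the
area of its projection. Finiteness is needed because the average is a Bochner integral, which would
be \<open>0\<close> for an indicator of infinite measure.\<close>

lemma graph_measure_finite: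
  assumes poly: "real_polynomial_function \<Phi>" and D: "D \<in> sets borel" "bounded D"
  shows "finite_measure (graph_measure \<Phi> c D)"
    and "X \<in> sets borel \<Longrightarrow> D0 \<in> sets borel \<Longrightarrow> D0 \<subseteq> D \<Longrightarrow>
      (\<And>x. x \<in> D0 \<Longrightarrow> vector [x $ 1, x $ 2, \<Phi> x + c] \<in> X) \<Longrightarrow>
      emeasure lborel D0 \<le> emeasure (graph_measure \<Phi> c D) X"
proof -
  let ?g = "\<lambda>x :: real^2. vector [x $ 1, x $ 2, \<Phi> x + c] :: real^3"
  define J where "J = (\<lambda>x. sqrt (1 + (pd 1 \<Phi> x)\<^sup>2 + (pd 2 \<Phi> x)\<^sup>2))"
  let ?w = "\<lambda>x. indicator D x * ennreal (J x)"
  let ?\<sigma> = "graph_measure \<Phi> c D"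
  have \<sigma>: "?\<sigma> = distr (density lborel ?w) borel ?g"
    by (simp add: graph_measure_def J_def)
  have g: "?g \<in> borel_measurable borel"
    by (intro borel_measurable_continuous_onI continuous_on_vector3 continuous_intros
        polynomial_continuous_on poly)
  have J: "continuous_on S J" for S
    unfolding J_def by (intro continuous_intros pd_polynomial poly)
  have w: "?w \<in> borel_measurable borel"
    using D borel_measurable_continuous_onI[OF J] by measurable
  have em: "emeasure ?\<sigma> X = (\<integral>\<^sup>+ x. ?w x * indicator (?g -` X) x \<partial>lborel)" if "X \<in> sets borel" for X
    using g w that measurable_sets[OF g that]
    by (simp add: \<sigma> emeasure_distr emeasure_density)
  obtain r where r: "D \<subseteq> cball 0 r" using D(2) by (auto simp: bounded_iff subset_iff)
  have "bounded (J ` cball 0 r)"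
    by (intro compact_imp_bounded compact_continuous_image J) auto
  then obtain B where B: "\<And>x. x \<in> cball 0 r \<Longrightarrow> J x \<le> B"
    unfolding bounded_iff by (metis abs_le_D1 imageI real_norm_def)
  have "emeasure ?\<sigma> UNIV \<le> (\<integral>\<^sup>+ x. ennreal B * indicator (cball (0::real^2) r) x \<partial>lborel)"
    unfolding em[OF sets.top[of borel, simplified space_borel]]
  proof (rule nn_integral_mono)
    show "?w x * indicator (?g -` UNIV) x \<le> ennreal B * indicator (cball 0 r) x" for x
      using r ennreal_leI[OF B[of x]] by (cases "x \<in> D") auto
  qed
  also have "\<dots> < \<infinity>"
    using emeasure_bounded_finite[of "cball (0::real^2) r"]
    by (simp add: nn_integral_cmult_indicator ennreal_mult_less_top)
  finally show "finite_measure ?\<sigma>"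
    by (intro finite_measureI) (simp add: \<sigma>)
  assume X: "X \<in> sets borel" and D0: "D0 \<in> sets borel" "D0 \<subseteq> D" "\<And>x. x \<in> D0 \<Longrightarrow> ?g x \<in> X"
  have J1: "1 \<le> ennreal (J x)" for x by (simp add: J_def)
  have "emeasure lborel D0 = (\<integral>\<^sup>+ x. indicator D0 x \<partial>lborel)" using D0 by simp
  also have "\<dots> \<le> emeasure ?\<sigma> X"
    unfolding em[OF X]
  proof (rule nn_integral_mono)
    show "indicator D0 x \<le> ?w x * indicator (?g -` X) x" for x
      using D0 J1[of x] by (cases "x \<in> D0") auto
  qed
  finally show "emeasure lborel D0 \<le> emeasure ?\<sigma> X" .
qed

text \<open>Some part of the dilated and reflected surface \<open>y - t S\<close> that lies over an area at least \<open>A\<close> is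
contained in \<open>E\<close>. This is the geometric content of every lower bound for the maximal function
below.\<close>

definition captures_area ::
  "(real^2 \<Rightarrow> real) \<Rightarrow> real \<Rightarrow> (real^2) set \<Rightarrow> (real^3) set \<Rightarrow> real \<Rightarrow> real^3 \<Rightarrow> bool" where
  "captures_area \<Phi> c D E A y \<longleftrightarrow>
     (\<exists>t\<in>{1..2}. \<exists>D0\<in>sets borel. D0 \<subseteq> D \<and> ennreal A \<le> emeasure lborel D0 \<and>
        (\<forall>x\<in>D0. y - t *\<^sub>R vector [x $ 1, x $ 2, \<Phi> x + c] \<in> E))"

lemma captures_areaI:
  assumes "1 \<le> t" "t \<le> 2" "D0 \<in> sets borel" "D0 \<subseteq> D" "ennreal A \<le> emeasure lborel D0"
    and "\<And>x. x \<in> D0 \<Longrightarrow> y - t *\<^sub>R vector [x $ 1, x $ 2, \<Phi> x + c] \<in> E"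
  shows "captures_area \<Phi> c D E A y"
  unfolding captures_area_def using assms
  by (intro bexI[where x = t] bexI[where x = D0] conjI ballI) auto

lemma local_maximal_ge:
  assumes poly: "real_polynomial_function \<Phi>" and D: "D \<in> sets borel" "bounded D"
    and E: "E \<in> sets borel" and captures: "captures_area \<Phi> c D E A y"
  shows "ennreal A \<le> local_maximal (graph_measure \<Phi> c D) (indicator E) y"
proof -
  obtain t D0 where t: "t \<in> {1..2}" and D0: "D0 \<in> sets borel" "D0 \<subseteq> D"
    and A: "ennreal A \<le> emeasure lborel D0"
    and hit: "\<forall>x\<in>D0. y - t *\<^sub>R vector [x $ 1, x $ 2, \<Phi> x + c] \<in> E"
    using captures unfolding captures_area_def by (elim bexE conjE) (erule (4) that)
  let ?\<sigma> = "graph_measure \<Phi> c D" and ?X = "(\<lambda>x. y - t *\<^sub>R x) -` E"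
  interpret finite_measure ?\<sigma> by (rule graph_measure_finite(1)[OF poly D])
  have sets: "sets ?\<sigma> = sets borel" by (simp add: graph_measure_def)
  have "(\<lambda>x. y - t *\<^sub>R x) \<in> borel_measurable borel" by measurable
  from measurable_sets[OF this E] have X: "?X \<in> sets borel" by simp
  have "surface_average ?\<sigma> t (indicator E) y = (\<integral>x. indicator ?X x \<partial>?\<sigma>)"
    by (simp add: surface_average_def indicator_def)
  also have "\<dots> = measure ?\<sigma> ?X"
    using X by (simp add: sets)
  finally have "ennreal \<bar>surface_average ?\<sigma> t (indicator E) y\<bar> = emeasure ?\<sigma> ?X"
    by (simp add: emeasure_eq_measure)
  moreover have "ennreal A \<le> emeasure ?\<sigma> ?X"
    using graph_measure_finite(2)[OF poly D X D0, of c] A hit by (auto intro: order_trans)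
  ultimately show ?thesis
    unfolding local_maximal_def by (intro SUP_upper2[OF t]) simp
qed

text \<open>The principle behind all the conditions: \<open>A \<bar>F\<bar>\<^bsup>1/q\<^esup> \<le> C \<bar>E\<bar>\<^bsup>1/p\<^esup>\<close> for the three powers of
\<open>\<delta>\<close>. The exponents are real so that test sets growing as \<open>\<delta> \<rightarrow> 0\<close> are included.\<close>

lemma test_family_exponents:
  fixes i j k k1 k2 k3 \<delta>0 :: real and E F :: "real \<Rightarrow> (real^3) set"
  assumes poly: "real_polynomial_function \<Phi>" and D: "D \<in> sets borel" "bounded D"
    and p: "1 \<le> p" and q: "1 \<le> q" and bdd: "maximal_bounded (graph_measure \<Phi> c D) p q"
    and pos: "0 < \<delta>0" "0 < k1" "0 < k2" "0 < k3"
    and E: "\<And>\<delta>. 0 < \<delta> \<Longrightarrow> \<delta> < \<delta>0 \<Longrightarrow> E \<delta> \<in> sets borel \<and> emeasure lborel (E \<delta>) \<le> ennreal (k3 * \<delta> powr k)"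
    and F: "\<And>\<delta>. 0 < \<delta> \<Longrightarrow> \<delta> < \<delta>0 \<Longrightarrow> F \<delta> \<in> sets borel \<and> ennreal (k2 * \<delta> powr j) \<le> emeasure lborel (F \<delta>)"
    and captures: "\<And>\<delta> y. 0 < \<delta> \<Longrightarrow> \<delta> < \<delta>0 \<Longrightarrow> y \<in> F \<delta> \<Longrightarrow>
      captures_area \<Phi> c D (E \<delta>) (k1 * \<delta> powr i) y"
  shows "k * recip p \<le> i + j * recip q"
proof -
  let ?\<sigma> = "graph_measure \<Phi> c D"
  obtain C where C: "0 \<le> C" and bound: "\<And>f. f \<in> borel_measurable borel \<Longrightarrow>
      Lp_norm p (\<lambda>y. ennreal \<bar>f y\<bar>) < \<infinity> \<Longrightarrow>
      Lp_norm q (local_maximal ?\<sigma> f) \<le> ennreal C * Lp_norm p (\<lambda>y. ennreal \<bar>f y\<bar>)"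
    using bdd unfolding maximal_bounded_def by blast
  show ?thesis
  proof (rule exponent_comparison)
    show "0 < \<delta>0" "0 < k1 * k2 powr recip q" using pos by auto
    fix \<delta> :: real assume \<delta>: "0 < \<delta>" "\<delta> < \<delta>0"
    have nE: "Lp_norm p (\<lambda>y. ennreal \<bar>indicator (E \<delta>) y\<bar>) \<le> ennreal ((k3 * \<delta> powr k) powr recip p)"
      using E[OF \<delta>] pos \<delta> by (intro Lp_norm_indicator_le p) auto
    have "ennreal (k1 * \<delta> powr i) \<le> local_maximal ?\<sigma> (indicator (E \<delta>)) y" if "y \<in> F \<delta>" for y
      using E[OF \<delta>] captures[OF \<delta> that] by (intro local_maximal_ge[OF poly D]) auto
    then have "ennreal (k1 * \<delta> powr i * (k2 * \<delta> powr j) powr recip q)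
        \<le> Lp_norm q (local_maximal ?\<sigma> (indicator (E \<delta>)))"
      using F[OF \<delta>] pos \<delta> by (intro Lp_norm_ge[OF q]) auto
    also have "\<dots> \<le> ennreal C * Lp_norm p (\<lambda>y. ennreal \<bar>indicator (E \<delta>) y\<bar>)"
      using E[OF \<delta>] nE by (intro bound) (auto intro: order_le_less_trans)
    also have "\<dots> \<le> ennreal C * ennreal ((k3 * \<delta> powr k) powr recip p)"
      by (intro mult_left_mono nE) auto
    also have "\<dots> = ennreal (C * (k3 * \<delta> powr k) powr recip p)"
      using C by (simp add: ennreal_mult)
    finally have "k1 * \<delta> powr i * (k2 * \<delta> powr j) powr recip q \<le> C * (k3 * \<delta> powr k) powr recip p"
      using C by (subst (asm) ennreal_le_iff) auto
    then show "k1 * k2 powr recip q * \<delta> powr (i + j * recip q)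
        \<le> C * k3 powr recip p * \<delta> powr (k * recip p)"
      using pos \<delta> by (simp add: powr_mult powr_powr powr_add mult_ac)
  qed
qed

section \<open>Necessary conditions for a homogeneous surface patch\<close>

text \<open>The part of the surface that the four conditions on the quadrilateral see: any open piece of the
parameter plane that contains an initial segment of a ray on which \<open>\<Phi>\<close> does not vanish.\<close>

locale surface_patch =
  fixes \<Phi> :: "real^2 \<Rightarrow> real" and m :: nat and D :: "(real^2) set" and v :: "real^2" and c \<rho> :: real
  assumes poly: "real_polynomial_function \<Phi>"
    and hom: "\<And>s x. \<Phi> (s *\<^sub>R x) = s ^ m * \<Phi> x"
    and m2: "2 \<le> m"
    and D_open: "open D" and D_ball: "D \<subseteq> ball 0 1"
    and \<rho>: "0 < \<rho>" and ray: "\<And>w. 0 < w \<Longrightarrow> w < \<rho> \<Longrightarrow> w *\<^sub>R v \<in> D"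
    and v: "\<Phi> v \<noteq> 0"
begin

lemma D_borel: "D \<in> sets borel" and D_bounded: "bounded D"
  using D_open D_ball bounded_subset[OF bounded_ball] by auto

lemma D_norm: "x \<in> D \<Longrightarrow> norm x \<le> 1"
  using D_ball by (auto simp: subset_iff less_imp_le)

lemma D_components: "x \<in> D \<Longrightarrow> \<bar>x $ 1\<bar> \<le> 1" "x \<in> D \<Longrightarrow> \<bar>x $ 2\<bar> \<le> 1"
  using D_norm component_le_norm_cart order_trans by blast+

lemma D_measure: "0 < measure lborel D" "emeasure lborel D = ennreal (measure lborel D)"
proof -
  have fin: "emeasure lborel D \<noteq> \<infinity>"
    using emeasure_bounded_finite[OF D_bounded] by simp
  then show eq: "emeasure lborel D = ennreal (measure lborel D)"
    by (simp add: emeasure_eq_ennreal_measure)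
  have "D \<noteq> {}" using ray[of "\<rho> / 2"] \<rho> by auto
  then have "emeasure lborel D \<noteq> 0"
    using open_not_negligible[OF D_open] D_borel by (simp add: negligible_iff_emeasure0)
  then show "0 < measure lborel D" unfolding eq by (simp add: ennreal_eq_0_iff not_le)
qed

text \<open>Along the ray \<open>\<Phi>\<close> takes different values at \<open>\<rho>/2\<close> and \<open>\<rho>/4\<close>, so \<open>c + \<beta> \<Phi>\<close> cannot vanish at
both points. The shrunk copies \<open>x0 / t\<close> are needed when a point is reached by the dilation with
factor \<open>t\<close>.\<close>

lemma ray_point_avoiding:
  assumes "\<beta> \<noteq> 0"
  obtains x0 where "\<And>t. t \<in> {1..2} \<Longrightarrow> (1 / t) *\<^sub>R x0 \<in> D" "c + \<beta> * \<Phi> x0 \<noteq> 0"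
proof -
  have pt: "(1 / t) *\<^sub>R (w *\<^sub>R v) \<in> D" if "t \<in> {1..2}" "0 < w" "w < \<rho>" for t w
  proof -
    have "0 < w / t" "w / t \<le> w" using that by (auto simp: field_simps)
    then show ?thesis using ray[of "w / t"] that by auto
  qed
  have "(\<rho> / 4) ^ m < (\<rho> / 2) ^ m"
    using \<rho> m2 by (intro power_strict_mono) auto
  then have "c + \<beta> * \<Phi> ((\<rho> / 2) *\<^sub>R v) \<noteq> c + \<beta> * \<Phi> ((\<rho> / 4) *\<^sub>R v)"
    unfolding hom using assms v by auto
  then have "c + \<beta> * \<Phi> ((\<rho> / 2) *\<^sub>R v) \<noteq> 0 \<or> c + \<beta> * \<Phi> ((\<rho> / 4) *\<^sub>R v) \<noteq> 0" by linarith
  then show ?thesis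
  proof
    assume "c + \<beta> * \<Phi> ((\<rho> / 2) *\<^sub>R v) \<noteq> 0"
    then show ?thesis by (intro that[of "(\<rho> / 2) *\<^sub>R v"] pt) (use \<rho> in auto)
  next
    assume "c + \<beta> * \<Phi> ((\<rho> / 4) *\<^sub>R v) \<noteq> 0"
    then show ?thesis by (intro that[of "(\<rho> / 4) *\<^sub>R v"] pt) (use \<rho> in auto)
  qed
qed

text \<open>The operator is a local translation-invariant one, and such an operator cannot improve decay at
infinity: cubes of side \<open>1/\<delta>\<close> show it as \<open>\<delta> \<rightarrow> 0\<close>. The threshold on \<open>\<delta>\<close> makes the surface small
compared with the cubes.\<close>

lemma large_ball_condition:
  assumes p: "1 \<le> p" and q: "1 \<le> q" and bdd: "maximal_bounded (graph_measure \<Phi> c D) p q"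
  shows "recip q \<le> recip p"
proof -
  obtain B0 where B0: "0 < B0" "\<And>x. norm x \<le> 1 \<Longrightarrow> \<bar>\<Phi> x\<bar> \<le> B0" using polynomial_bounded[OF poly] by metis
  define B where "B = B0 + \<bar>c\<bar> + 1"
  have B: "1 \<le> B" "\<And>x. x \<in> D \<Longrightarrow> \<bar>\<Phi> x + c\<bar> \<le> B" 
    using B0 D_norm by (force simp: B_def)+
  define Q where "Q r = {z :: real^3. \<bar>z $ 1 - 0\<bar> \<le> r \<and> \<bar>z $ 2 - 0\<bar> \<le> r \<and> \<bar>z $ 3 - 0\<bar> \<le> r}" for r :: real
  note Q = box3[of r r r 0 0 0 for r, folded Q_def]
  have pw: "\<delta> powr - 3 = 1 / \<delta> ^ 3" if "0 < \<delta>" for \<delta> :: real using that by (simp add: powr_minus_divide)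
  have "- 3 * recip p \<le> 0 + - 3 * recip q"
  proof (rule test_family_exponents[OF poly D_borel D_bounded p q bdd,
        where E = "\<lambda>\<delta>. Q (1 / \<delta>)" and F = "\<lambda>\<delta>. Q (1 / (2 * \<delta>))"])
    show "0 < 1 / (2 * B)" "0 < measure lborel D" "(0::real) < 1" "(0::real) < 8" using B D_measure by auto
    fix \<delta> :: real assume \<delta>: "0 < \<delta>" "\<delta> < 1 / (2 * B)"
    then show "Q (1 / \<delta>) \<in> sets borel \<and> emeasure lborel (Q (1 / \<delta>)) \<le> ennreal (8 * \<delta> powr - 3)"
      "Q (1 / (2 * \<delta>)) \<in> sets borel \<and> ennreal (1 * \<delta> powr - 3) \<le> emeasure lborel (Q (1 / (2 * \<delta>)))"
      by (simp_all add: Q pw power3_eq_cube)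
    fix y assume y: "y \<in> Q (1 / (2 * \<delta>))"
    show "captures_area \<Phi> c D (Q (1 / \<delta>)) (measure lborel D * \<delta> powr 0) y"
    proof (rule captures_areaI[of 1 D])
      fix x assume x: "x \<in> D"
      have "2 * B < 1 / \<delta>" "1 / (2 * \<delta>) = (1 / \<delta>) / 2" using B \<delta> by (simp_all add: field_simps)
      then show "y - 1 *\<^sub>R vector [x $ 1, x $ 2, \<Phi> x + c] \<in> Q (1 / \<delta>)"
        using y D_components[OF x] B(2)[OF x] B(1) by (simp add: Q_def abs_le_iff)
    qed (use D_borel D_measure \<delta> in auto)
  qed
  then show ?thesis by simp
qed

text \<open>For \<open>y\<close> within \<open>\<delta>\<close> of the origin, the whole of \<open>y - S\<close> lies in the \<open>K\<delta>\<close>-neighbourhood of \<open>- S\<close>,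
by the Lipschitz bound for \<open>\<Phi>\<close>.\<close>

lemma graph_condition:
  assumes p: "1 \<le> p" and q: "1 \<le> q" and bdd: "maximal_bounded (graph_measure \<Phi> c D) p q"
  shows "recip p \<le> 3 * recip q"
proof -
  obtain L where L: "0 < L" "\<And>x y. norm x \<le> 3 \<Longrightarrow> norm y \<le> 3 \<Longrightarrow> \<bar>\<Phi> x - \<Phi> y\<bar> \<le> L * norm (x - y)"
    using polynomial_Lipschitz[OF poly] by blast
  define K where "K = 1 + 2 * L"
  have K: "0 < K" using L by (simp add: K_def)
  define f where "f = (\<lambda>u. - ((-1) ^ m) * \<Phi> u - c)"
  have f: "real_polynomial_function f"
    unfolding f_def by (intro real_polynomial_function_diff real_polynomial_function.intros poly)
  have f_minus: "f u = - \<Phi> (- u) - c" for u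
    using hom[of "-1" u] by (simp add: f_def)
  define E where "E \<delta> = {z :: real^3. \<bar>z $ 1\<bar> \<le> 2 \<and> \<bar>z $ 2\<bar> \<le> 2 \<and>
      \<bar>z $ 3 - f (vector [z $ 1, z $ 2])\<bar> \<le> K * \<delta>}" for \<delta>
  define F where "F \<delta> = {z :: real^3. \<bar>z $ 1 - 0\<bar> \<le> \<delta> \<and> \<bar>z $ 2 - 0\<bar> \<le> \<delta> \<and> \<bar>z $ 3 - 0\<bar> \<le> \<delta>}" for \<delta> :: real
  have "1 * recip p \<le> 0 + 3 * recip q"
  proof (rule test_family_exponents[OF poly D_borel D_bounded p q bdd, where E = E and F = F])
    show "(0::real) < 1" "0 < measure lborel D" "(0::real) < 8" "0 < 32 * K" using K D_measure by auto
    fix \<delta> :: real assume \<delta>: "0 < \<delta>" "\<delta> < 1"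
    show "E \<delta> \<in> sets borel \<and> emeasure lborel (E \<delta>) \<le> ennreal (32 * K * \<delta> powr 1)"
      using graph_neighbourhood_measure[OF f, of 2 2 "K * \<delta>", folded E_def] \<delta> K by (simp add: mult_ac)
    show "F \<delta> \<in> sets borel \<and> ennreal (8 * \<delta> powr 3) \<le> emeasure lborel (F \<delta>)"
      using box3[of \<delta> \<delta> \<delta> 0 0 0, folded F_def] \<delta> by (simp add: power3_eq_cube mult_ac)
    fix y assume y: "y \<in> F \<delta>"
    show "captures_area \<Phi> c D (E \<delta>) (measure lborel D * \<delta> powr 0) y"
    proof (rule captures_areaI[of 1 D])
      fix x assume x: "x \<in> D"
      define a where "a = (vector [y $ 1, y $ 2] :: real^2)"
      have a: "norm a \<le> 2 * \<delta>" using norm_le_components2[of a] y by (simp add: a_def F_def)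
      have xa: "norm (x - a) \<le> 3" "norm x \<le> 3"
        using norm_triangle_ineq4[of x a] D_norm[OF x] a \<delta> by auto
      have "- vector [y $ 1 - x $ 1, y $ 2 - x $ 2] = x - a"
        by (simp add: a_def vec_eq_iff forall_2)
      then have fv: "f (vector [y $ 1 - x $ 1, y $ 2 - x $ 2]) = - \<Phi> (x - a) - c" by (simp add: f_minus)
      have "\<bar>\<Phi> (x - a) - \<Phi> x\<bar> \<le> L * norm a" using L(2)[OF xa] by simp
      also have "\<dots> \<le> L * (2 * \<delta>)" using a L by (intro mult_left_mono) auto
      finally have "\<bar>\<Phi> (x - a) - \<Phi> x\<bar> \<le> 2 * L * \<delta>" by simp
      moreover have "K * \<delta> = \<delta> + 2 * L * \<delta>" by (simp add: K_def algebra_simps)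
      ultimately show "y - 1 *\<^sub>R vector [x $ 1, x $ 2, \<Phi> x + c] \<in> E \<delta>"
        using y D_components[OF x] \<delta> by (simp add: E_def F_def fv abs_le_iff)
    qed (use D_borel D_measure \<delta> in auto)
  qed
  then show ?thesis by simp
qed

text \<open>The point \<open>y\<close> lies on the dilate \<open>t S\<close> precisely if \<open>y\<^sub>3 = H(t)\<close> with
\<open>H(t) = t (\<Phi>(y') / t\<^sup>m + c)\<close> and \<open>y' = (y\<^sub>1, y\<^sub>2)\<close>. At \<open>y' = x0\<close> the values \<open>H(1)\<close>
and \<open>H(2)\<close> differ by \<open>d \<noteq> 0\<close>, so for \<open>y'\<close> near \<open>x0\<close> the intermediate value theorem finds a suitable
\<open>t\<close> for all \<open>y\<^sub>3\<close> in a fixed interval around the midpoint. Hence \<open>F\<close> is a fixed box, and the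
surface measure of a \<open>\<delta>\<close>-square around the point \<open>y'/t\<close> supplies the factor \<open>\<delta>\<^sup>2\<close>.\<close>

lemma small_ball_condition:
  assumes p: "1 \<le> p" and q: "1 \<le> q" and bdd: "maximal_bounded (graph_measure \<Phi> c D) p q"
  shows "3 * recip p \<le> 2"
proof -
  \<comment> \<open>the ratio between \<open>t \<Phi>(y'/t)\<close> at \<open>t = 2\<close> and at \<open>t = 1\<close>\<close>
  define \<theta> :: real where "\<theta> = 2 / 2 ^ m"
  have "(2::real) ^ 2 \<le> 2 ^ m" using m2 by (intro power_increasing) auto
  then have \<theta>: "0 < \<theta>" "\<theta> \<le> 1 / 2" by (simp_all add: \<theta>_def field_simps)
  then obtain x0 where x0: "\<And>t. t \<in> {1..2} \<Longrightarrow> (1 / t) *\<^sub>R x0 \<in> D" "c + (\<theta> - 1) * \<Phi> x0 \<noteq> 0"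
    using ray_point_avoiding[of "\<theta> - 1"] by auto
  define d where "d = c + (\<theta> - 1) * \<Phi> x0"
  have d: "0 < \<bar>d\<bar>" using x0 by (simp add: d_def)
  have "compact ((\<lambda>t. (1 / t) *\<^sub>R x0) ` {1..2::real})"
    by (intro compact_continuous_image continuous_intros) auto
  then obtain e where e: "0 < e" "(\<Union>x\<in>(\<lambda>t. (1 / t) *\<^sub>R x0) ` {1..2}. ball x e) \<subseteq> D"
    using compact_subset_open_imp_ball_epsilon_subset[OF _ D_open] x0(1) by blast
  have nx0: "norm x0 \<le> 1" using D_norm x0(1)[of 1] by simp
  obtain L where L: "0 < L" "\<And>x y. norm x \<le> 2 \<Longrightarrow> norm y \<le> 2 \<Longrightarrow> \<bar>\<Phi> x - \<Phi> y\<bar> \<le> L * norm (x - y)"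
    using polynomial_Lipschitz[OF poly] by blast
  \<comment> \<open>half-side of \<open>F\<close>: it keeps \<open>y'/t\<close> inside \<open>D\<close>, \<open>y'\<close> in the disc of radius \<open>2\<close>, and \<open>\<Phi>(y')\<close> within \<open>\<bar>d\<bar>/4\<close> of \<open>\<Phi>(x0)\<close>\<close>
  define s where "s = Min {e / 4, 1 / 2, \<bar>d\<bar> / (8 * L)}"
  have s: "0 < s" "s \<le> e / 4" "s \<le> 1 / 2" "s \<le> \<bar>d\<bar> / (8 * L)" using e d L by (auto simp: s_def)
  have sL: "L * (2 * s) \<le> \<bar>d\<bar> / 4" using s(4) L by (simp add: field_simps)
  define K where "K = 2 + 4 * L"
  have K: "0 < K" using L by (simp add: K_def)
  define E where "E \<delta> = {z :: real^3. \<bar>z $ 1 - 0\<bar> \<le> K * \<delta> \<and> \<bar>z $ 2 - 0\<bar> \<le> K * \<delta> \<and> \<bar>z $ 3 - 0\<bar> \<le> K * \<delta>}" for \<delta> :: real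
  define F where "F = {z :: real^3. \<bar>z $ 1 - x0 $ 1\<bar> \<le> s \<and> \<bar>z $ 2 - x0 $ 2\<bar> \<le> s \<and>
      \<bar>z $ 3 - (\<Phi> x0 + c + d / 2)\<bar> \<le> \<bar>d\<bar> / 4}"
  have "3 * recip p \<le> 2 + 0 * recip q"
  proof (rule test_family_exponents[OF poly D_borel D_bounded p q bdd, where E = E and F = "\<lambda>\<delta>. F"])
    show "0 < e / 4" "(0::real) < 4" "0 < 8 * s * s * (\<bar>d\<bar> / 4)" "0 < 8 * K ^ 3" using K e s d by auto
    fix \<delta> :: real assume \<delta>: "0 < \<delta>" "\<delta> < e / 4"
    show "E \<delta> \<in> sets borel \<and> emeasure lborel (E \<delta>) \<le> ennreal (8 * K ^ 3 * \<delta> powr 3)"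
      using box3[of "K * \<delta>" "K * \<delta>" "K * \<delta>" 0 0 0, folded E_def] \<delta> K
      by (simp add: power3_eq_cube mult_ac)
    show "F \<in> sets borel \<and> ennreal (8 * s * s * (\<bar>d\<bar> / 4) * \<delta> powr 0) \<le> emeasure lborel F"
      using box3[of s s "\<bar>d\<bar> / 4" "x0 $ 1" "x0 $ 2" "\<Phi> x0 + c + d / 2", folded F_def] \<delta> s by simp
    fix y assume y: "y \<in> F"
    define y' where "y' = (vector [y $ 1, y $ 2] :: real^2)"
    have y'x0: "norm (y' - x0) \<le> 2 * s"
      using norm_le_components2[of "y' - x0"] y by (simp add: y'_def F_def)
    then have ny': "norm y' \<le> 2" using nx0 s norm_triangle_sub[of y' x0] by linarith
    have "\<bar>\<Phi> y' - \<Phi> x0\<bar> \<le> L * norm (y' - x0)" using ny' nx0 by (intro L(2)) auto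
    also have "\<dots> \<le> L * (2 * s)" using L(1) y'x0 by (intro mult_left_mono) auto
    finally have \<Phi>y': "\<bar>\<Phi> y' - \<Phi> x0\<bar> \<le> \<bar>d\<bar> / 4" using sL by linarith
    moreover have "\<bar>\<theta> * \<Phi> y' - \<theta> * \<Phi> x0\<bar> \<le> 1 * \<bar>\<Phi> y' - \<Phi> x0\<bar>"
      unfolding right_diff_distrib[symmetric] abs_mult using \<theta> by (intro mult_right_mono) auto
    ultimately have \<theta>\<Phi>: "\<bar>\<theta> * \<Phi> y' - \<theta> * \<Phi> x0\<bar> \<le> \<bar>d\<bar> / 4"
      unfolding mult_1 by (rule order_trans[rotated])
    have y3: "\<bar>y $ 3 - (\<Phi> x0 + c + d / 2)\<bar> \<le> \<bar>d\<bar> / 4" using y by (simp add: F_def)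
    define H where "H t = t * (\<Phi> y' / t ^ m + c)" for t
    have cont: "continuous_on {1..2} H" unfolding H_def by (intro continuous_intros) auto
    have H12: "H 1 = \<Phi> y' + c" "H 2 = \<theta> * \<Phi> y' + 2 * c" by (simp_all add: H_def \<theta>_def field_simps)
    have dd: "\<theta> * \<Phi> x0 = d - c + \<Phi> x0" by (simp add: d_def algebra_simps)
    have "\<exists>t. 1 \<le> t \<and> t \<le> 2 \<and> H t = y $ 3"
    proof (cases "0 \<le> d")
      case True
      then have "H 1 \<le> y $ 3" "y $ 3 \<le> H 2"
        unfolding H12 using y3 \<Phi>y' \<theta>\<Phi> dd by linarith+
      then show ?thesis by (intro IVT' cont) auto
    next
      case False
      then have "H 2 \<le> y $ 3" "y $ 3 \<le> H 1"
        unfolding H12 using y3 \<Phi>y' \<theta>\<Phi> dd by linarith+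
      then show ?thesis by (intro IVT2' cont) auto
    qed
    then obtain t where t: "1 \<le> t" "t \<le> 2" "H t = y $ 3" by blast
    define xy where "xy = (1 / t) *\<^sub>R y'"
    have nxy: "norm xy \<le> 2" using t ny' by (simp add: xy_def field_simps)
    have xy: "t * xy $ 1 = y $ 1" "t * xy $ 2 = y $ 2" using t by (simp_all add: xy_def y'_def)
    have y3eq: "y $ 3 = t * (\<Phi> xy + c)"
      using t(3) hom[of "1 / t" y'] by (simp add: H_def xy_def power_inverse divide_inverse mult_ac)
    define D0 where "D0 = {x :: real^2. \<bar>x $ 1 - xy $ 1\<bar> \<le> \<delta> \<and> \<bar>x $ 2 - xy $ 2\<bar> \<le> \<delta>}"
    note D0 = box2[of \<delta> \<delta> "xy $ 1" "xy $ 2", folded D0_def]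
    have D0_norm: "norm (x - xy) \<le> 2 * \<delta>" if "x \<in> D0" for x
      using norm_le_components2[of "x - xy"] that by (simp add: D0_def)
    have D0D: "D0 \<subseteq> D"
    proof
      fix x assume x: "x \<in> D0"
      have "norm (x - (1 / t) *\<^sub>R x0) = norm ((x - xy) + (1 / t) *\<^sub>R (y' - x0))"
        by (simp add: xy_def algebra_simps)
      also have "\<dots> \<le> norm (x - xy) + norm ((1 / t) *\<^sub>R (y' - x0))" by (rule norm_triangle_ineq)
      also have "norm ((1 / t) *\<^sub>R (y' - x0)) \<le> norm (y' - x0)"
        using t by (simp add: divide_le_eq mult_le_cancel_left1)
      finally have "norm (x - (1 / t) *\<^sub>R x0) < e"
        using D0_norm[OF x] y'x0 \<delta> s by linarith
      then show "x \<in> D" using e(2) t(1,2) by (force simp: dist_norm norm_minus_commute)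
    qed
    show "captures_area \<Phi> c D (E \<delta>) (4 * \<delta> powr 2) y"
    proof (rule captures_areaI[OF t(1,2) _ D0D])
      show "D0 \<in> sets borel" "ennreal (4 * \<delta> powr 2) \<le> emeasure lborel D0"
        using D0 \<delta> by (simp_all add: power2_eq_square mult_ac)
      fix x assume x: "x \<in> D0"
      have "\<bar>\<Phi> xy - \<Phi> x\<bar> \<le> L * norm (x - xy)"
        using L(2)[OF nxy, of x] D_norm[of x] D0D x by (auto simp: norm_minus_commute)
      also have "\<dots> \<le> L * (2 * \<delta>)" using L D0_norm[OF x] by (intro mult_left_mono) auto
      finally have *: "\<bar>\<Phi> xy - \<Phi> x\<bar> \<le> L * (2 * \<delta>)" .
      have t_bd: "\<bar>t * b\<bar> \<le> K * \<delta>" if "\<bar>b\<bar> \<le> \<delta> \<or> \<bar>b\<bar> \<le> L * (2 * \<delta>)" for b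
      proof -
        have "\<bar>b\<bar> \<le> \<delta> + L * (2 * \<delta>)" using that \<delta> L by (auto intro: add_increasing add_increasing2)
        then have "\<bar>t * b\<bar> \<le> 2 * (\<delta> + L * (2 * \<delta>))"
          unfolding abs_mult using t \<delta> L by (intro mult_mono) auto
        then show ?thesis by (simp add: K_def algebra_simps)
      qed
      have "\<bar>xy $ 1 - x $ 1\<bar> \<le> \<delta>" "\<bar>xy $ 2 - x $ 2\<bar> \<le> \<delta>"
        using x by (simp_all add: D0_def abs_minus_commute)
      then show "y - t *\<^sub>R vector [x $ 1, x $ 2, \<Phi> x + c] \<in> E \<delta>"
        using t_bd[of "xy $ 1 - x $ 1"] t_bd[of "xy $ 2 - x $ 2"] t_bd[of "\<Phi> xy - \<Phi> x"] *
        by (simp add: E_def y3eq algebra_simps xy)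
    qed
  qed
  then show ?thesis by simp
qed

text \<open>Euler's identity, from differentiating \<open>\<Phi>((1 + s) x0) = (1 + s)\<^sup>m \<Phi>(x0)\<close> at \<open>s = 0\<close>.\<close>

lemma Euler_relation:
  assumes "(\<Phi> has_derivative L) (at x0)"
  shows "L x0 = real m * \<Phi> x0"
proof -
  have lin: "((\<lambda>s. (1 + s) *\<^sub>R x0) has_derivative (\<lambda>s. s *\<^sub>R x0)) (at 0)"
    by (auto intro!: derivative_eq_intros)
  have "((\<lambda>s. \<Phi> ((1 + s) *\<^sub>R x0)) has_derivative (\<lambda>s. L (s *\<^sub>R x0))) (at 0)"
    using has_derivative_compose[OF lin, of \<Phi> L] assms by simp
  moreover have "((\<lambda>s. (1 + s) ^ m * \<Phi> x0) has_derivative (\<lambda>s. s * (real m * \<Phi> x0))) (at 0)"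
    by (auto intro!: derivative_eq_intros)
  ultimately have "(\<lambda>s. L (s *\<^sub>R x0)) = (\<lambda>s. s * (real m * \<Phi> x0))"
    unfolding hom by (rule has_derivative_unique)
  from fun_cong[OF this, of 1] show ?thesis by simp
qed

text \<open>Over the \<open>\<delta>\<close>-square around \<open>x0\<close> the surface stays within \<open>O(\<delta>\<^sup>2)\<close> of its tangent plane. Let
\<open>\<kappa> = \<Phi>(x0) + c - \<nabla>\<Phi>(x0) \<cdot> x0\<close> be the value of the linear form \<open>y\<^sub>3 - \<nabla>\<Phi>(x0) \<cdot> y'\<close> at
the point of the surface over \<open>x0\<close>, and \<open>h(y)\<close> its value at \<open>y\<close> divided by \<open>\<kappa>\<close>. Dilating by
\<open>t = h(y)\<close> places \<open>y\<close> exactly on the dilated tangent plane. So \<open>F\<close> is a tube around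
the segment swept out by that point, and it has volume of order \<open>\<delta>\<^sup>2\<close> because \<open>\<kappa> \<noteq> 0\<close>, which by
Euler's identity means \<open>c + (1 - m) \<Phi>(x0) \<noteq> 0\<close>.\<close>

lemma Knapp_condition:
  assumes p: "1 \<le> p" and q: "1 \<le> q" and bdd: "maximal_bounded (graph_measure \<Phi> c D) p q"
  shows "2 * recip p \<le> 1 + recip q"
proof -
  have "1 - real m \<noteq> 0" using m2 by auto
  then obtain x0 where x0: "x0 \<in> D" "c + (1 - real m) * \<Phi> x0 \<noteq> 0"
    using ray_point_avoiding[of "1 - real m"] by (metis atLeastAtMost_iff div_by_1 one_le_numeral order_refl scaleR_one)
  obtain L M where LM: "bounded_linear L" "(\<Phi> has_derivative L) (at x0)" "0 < M"
    "\<And>x. norm (x - x0) \<le> 1 \<Longrightarrow> \<bar>\<Phi> x - \<Phi> x0 - L (x - x0)\<bar> \<le> M * (norm (x - x0))\<^sup>2"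
    using polynomial_Taylor2[OF poly, of x0] by blast
  interpret L: bounded_linear L by fact
  define g1 where "g1 = L (axis 1 1)"
  define g2 where "g2 = L (axis 2 1)"
  have L: "L h = g1 * h $ 1 + g2 * h $ 2" for h
  proof -
    have "h = h $ 1 *\<^sub>R axis 1 1 + h $ 2 *\<^sub>R axis 2 1" by (simp add: vec_eq_iff forall_2 axis_def)
    then have "L h = L (h $ 1 *\<^sub>R axis 1 1 + h $ 2 *\<^sub>R axis 2 1)" by simp
    then show ?thesis by (simp add: L.add L.scaleR g1_def g2_def)
  qed
  define \<kappa> where "\<kappa> = \<Phi> x0 + c - L x0"
  have \<kappa>: "\<kappa> \<noteq> 0" using x0(2) Euler_relation[OF LM(2)] by (simp add: \<kappa>_def algebra_simps)
  obtain e where e: "0 < e" "ball x0 e \<subseteq> D" using D_open x0(1) open_contains_ball by blast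
  define E where "E \<delta> = {z :: real^3. \<bar>z $ 1 - 0\<bar> \<le> 3 * \<delta> \<and> \<bar>z $ 2 - 0 * z $ 1 - 0\<bar> \<le> 3 * \<delta> \<and>
      \<bar>z $ 3 - g1 * z $ 1 - g2 * z $ 2 - 0\<bar> \<le> 8 * M * \<delta>\<^sup>2}" for \<delta>
  define h where "h z = (z $ 3 - g1 * z $ 1 - g2 * z $ 2) / \<kappa>" for z :: "real^3"
  define F where "F \<delta> = {z. \<bar>z $ 1 - h z * x0 $ 1\<bar> \<le> \<delta> \<and> \<bar>z $ 2 - h z * x0 $ 2\<bar> \<le> \<delta> \<and> 1 \<le> h z \<and> h z \<le> 2}" for \<delta>
  have "4 * recip p \<le> 2 + 2 * recip q"
  proof (rule test_family_exponents[OF poly D_borel D_bounded p q bdd, where E = E and F = F])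
    show "0 < min 1 e / 2" "(0::real) < 4" "0 < 4 * \<bar>\<kappa>\<bar>" "0 < 576 * M" using \<kappa> e LM by auto
    fix \<delta> :: real assume \<delta>: "0 < \<delta>" "\<delta> < min 1 e / 2"
    show "E \<delta> \<in> sets borel \<and> emeasure lborel (E \<delta>) \<le> ennreal (576 * M * \<delta> powr 4)"
      using shear_box3[of "3 * \<delta>" "3 * \<delta>" "8 * M * \<delta>\<^sup>2" 0 0 0 g1 g2 0, folded E_def] \<delta> LM(3)
      by (simp add: power4_eq_xxxx power2_eq_square mult_ac)
    show "F \<delta> \<in> sets borel \<and> ennreal (4 * \<bar>\<kappa>\<bar> * \<delta> powr 2) \<le> emeasure lborel (F \<delta>)"
      using tube_measure[of \<delta> \<kappa> g1 g2 "x0 $ 1" "x0 $ 2", folded h_def, folded F_def] \<delta> \<kappa>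
      by (simp add: mult_ac)
    fix y assume y: "y \<in> F \<delta>"
    then have t: "1 \<le> h y" "h y \<le> 2" by (simp_all add: F_def)
    define D0 where "D0 = {x :: real^2. \<bar>x $ 1 - x0 $ 1\<bar> \<le> \<delta> \<and> \<bar>x $ 2 - x0 $ 2\<bar> \<le> \<delta>}"
    note D0 = box2[of \<delta> \<delta> "x0 $ 1" "x0 $ 2", folded D0_def]
    have D0_norm: "norm (x - x0) \<le> 2 * \<delta>" if "x \<in> D0" for x
      using norm_le_components2[of "x - x0"] that by (simp add: D0_def)
    have D0D: "D0 \<subseteq> D"
      using D0_norm \<delta> e(2) by (force simp: dist_norm norm_minus_commute)
    show "captures_area \<Phi> c D (E \<delta>) (4 * \<delta> powr 2) y"
    proof (rule captures_areaI[OF t _ D0D])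
      show "D0 \<in> sets borel" "ennreal (4 * \<delta> powr 2) \<le> emeasure lborel D0"
        using D0 \<delta> by (simp_all add: power2_eq_square mult_ac)
      fix x assume x: "x \<in> D0"
      define z where "z = y - h y *\<^sub>R (vector [x $ 1, x $ 2, \<Phi> x + c] :: real^3)"
      have step: "\<bar>u - h y * w\<bar> \<le> 3 * \<delta>" if "\<bar>u - h y * w0\<bar> \<le> \<delta>" "\<bar>w - w0\<bar> \<le> \<delta>" for u w w0
      proof -
        have "\<bar>h y * (w - w0)\<bar> \<le> 2 * \<delta>" unfolding abs_mult using t that by (intro mult_mono) auto
        moreover have "u - h y * w = (u - h y * w0) - h y * (w - w0)" by (simp add: algebra_simps)
        ultimately show ?thesis using that by linarith
      qed
      have "\<bar>z $ 1\<bar> \<le> 3 * \<delta>" "\<bar>z $ 2\<bar> \<le> 3 * \<delta>"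
        using step x y by (auto simp: z_def D0_def F_def)
      moreover have "\<bar>z $ 3 - g1 * z $ 1 - g2 * z $ 2\<bar> \<le> 8 * M * \<delta>\<^sup>2"
      proof -
        have "y $ 3 - g1 * y $ 1 - g2 * y $ 2 = h y * \<kappa>" using \<kappa> by (simp add: h_def)
        then have "z $ 3 - g1 * z $ 1 - g2 * z $ 2 = h y * \<kappa> - h y * (\<Phi> x + c - L x)"
          by (simp add: z_def L algebra_simps)
        also have "\<dots> = h y * - (\<Phi> x - \<Phi> x0 - L (x - x0))"
          by (simp add: \<kappa>_def L.diff algebra_simps)
        finally have eq: "\<bar>z $ 3 - g1 * z $ 1 - g2 * z $ 2\<bar> = h y * \<bar>\<Phi> x - \<Phi> x0 - L (x - x0)\<bar>"
          using t by (simp add: abs_mult)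
        have "\<bar>\<Phi> x - \<Phi> x0 - L (x - x0)\<bar> \<le> M * (norm (x - x0))\<^sup>2"
          using D0_norm[OF x] \<delta> by (intro LM(4)) auto
        also have "\<dots> \<le> M * (2 * \<delta>)\<^sup>2" using LM D0_norm[OF x] by (intro mult_left_mono power_mono) auto
        finally have "h y * \<bar>\<Phi> x - \<Phi> x0 - L (x - x0)\<bar> \<le> 2 * (M * (2 * \<delta>)\<^sup>2)"
          using t by (intro mult_mono) auto
        then show ?thesis unfolding eq by (simp add: power2_eq_square)
      qed
      ultimately show "y - h y *\<^sub>R vector [x $ 1, x $ 2, \<Phi> x + c] \<in> E \<delta>"
        by (simp add: E_def flip: z_def)
    qed
  qed
  then show ?thesis by simp
qed

text \<open>The case \<open>k = 0\<close> is a strip of length \<open>1\<close> along the line, the case \<open>k = 1\<close> a square at the origin;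
the hypothesis says that \<open>\<Phi>\<close> is of size \<open>\<delta>\<^sup>N\<close> there. On such a piece the graph is within
\<open>O(\<delta>\<^sup>N)\<close> of the horizontal plane at height \<open>c\<close>. If \<open>c \<noteq> 0\<close>, any \<open>y\<^sub>3\<close> between \<open>c\<close> and
\<open>2c\<close> is matched by the dilation \<open>t = y\<^sub>3 / c\<close>; if \<open>c = 0\<close>, dilations do not help and
\<open>\<bar>y\<^sub>3\<bar> \<le> \<delta>\<^sup>N\<close> is imposed.\<close>

lemma anisotropic_condition:
  fixes k N :: nat and l \<eta> B :: real
  assumes p: "1 \<le> p" and q: "1 \<le> q" and bdd: "maximal_bounded (graph_measure \<Phi> c D) p q"
    and \<eta>: "0 < \<eta>" and cone: "\<And>x. 0 < x $ 1 \<Longrightarrow> x $ 1 < \<rho> \<Longrightarrow> \<bar>x $ 2 - l * x $ 1\<bar> < \<eta> * x $ 1 \<Longrightarrow> x \<in> D"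
    and k: "k \<le> 1" and B: "0 < B"
    and small: "\<And>x \<delta>. 0 < \<delta> \<Longrightarrow> \<delta> < 1 \<Longrightarrow> \<bar>x $ 1\<bar> \<le> \<delta> ^ k \<Longrightarrow> \<bar>x $ 2 - l * x $ 1\<bar> \<le> \<delta> \<Longrightarrow> \<bar>\<Phi> x\<bar> \<le> B * \<delta> ^ N"
  shows "c = 0 \<Longrightarrow> real (k + 1 + N) * recip p \<le> real (k + 1) + real (k + 1 + N) * recip q"
    and "c \<noteq> 0 \<Longrightarrow> real (k + 1 + N) * recip p \<le> real (k + 1) + real (k + 1) * recip q"
proof -
  \<comment> \<open>factors that keep the parallelogram \<open>D0\<close> below inside the cone and inside the region where \<open>\<Phi>\<close> is small\<close>
  define \<tau> where "\<tau> = min \<rho> 1 / 4"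
  define \<tau>' where "\<tau>' = min 1 (\<eta> * \<tau> / 4)"
  have \<tau>: "0 < \<tau>" "\<tau> \<le> \<rho> / 4" "\<tau> \<le> 1 / 4" using \<rho> by (auto simp: \<tau>_def)
  have \<tau>': "0 < \<tau>'" "\<tau>' \<le> 1" "\<tau>' \<le> \<eta> * \<tau> / 4" using \<eta> \<tau> by (auto simp: \<tau>'_def)
  define E where "E \<delta> = {z :: real^3. \<bar>z $ 1 - 0\<bar> \<le> 3 * \<delta> ^ k \<and> \<bar>z $ 2 - l * z $ 1 - 0\<bar> \<le> 3 * \<delta> \<and>
      \<bar>z $ 3 - 0 * z $ 1 - 0 * z $ 2 - 0\<bar> \<le> (2 * B + 1) * \<delta> ^ N}" for \<delta>
  define F where "F h r \<delta> = {z :: real^3. \<bar>z $ 1 - 0\<bar> \<le> \<delta> ^ k \<and> \<bar>z $ 2 - l * z $ 1 - 0\<bar> \<le> \<delta> \<and>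
      \<bar>z $ 3 - 0 * z $ 1 - 0 * z $ 2 - h\<bar> \<le> r}" for h r \<delta>
  have powr: "\<delta> powr real n = \<delta> ^ n" if "0 < \<delta>" for \<delta> n using that by (rule powr_realpow)
  have E: "E \<delta> \<in> sets borel \<and> emeasure lborel (E \<delta>) \<le> ennreal (72 * (2 * B + 1) * \<delta> powr real (k + 1 + N))"
    if "0 < \<delta>" for \<delta>
    using shear_box3[of "3 * \<delta> ^ k" "3 * \<delta>" "(2 * B + 1) * \<delta> ^ N" 0 l 0 0 0 0, folded E_def] that B
    unfolding powr[OF that] by (simp add: power_add mult_ac)
  have F: "F h r \<delta> \<in> sets borel" "emeasure lborel (F h r \<delta>) = ennreal (8 * \<delta> ^ k * \<delta> * r)"
    if "0 < \<delta>" "0 \<le> r" for h r \<delta>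
    using shear_box3[of "\<delta> ^ k" \<delta> r 0 l 0 0 0 h, folded F_def] that by simp_all
  have captures: "captures_area \<Phi> c D (E \<delta>) (\<tau> * \<tau>' * 2 * \<delta> powr real (k + 1)) y"
    if \<delta>: "0 < \<delta>" "\<delta> < 1" and y: "\<bar>y $ 1\<bar> \<le> \<delta> ^ k" "\<bar>y $ 2 - l * y $ 1\<bar> \<le> \<delta>"
      and t: "1 \<le> t" "t \<le> 2" "\<bar>y $ 3 - t * c\<bar> \<le> \<delta> ^ N" for \<delta> y t
  proof -
    define D0 where "D0 = {x :: real^2. \<bar>x $ 1 - \<tau> * \<delta> ^ k\<bar> \<le> \<tau> * \<delta> ^ k / 2 \<and>
        \<bar>x $ 2 - l * x $ 1 - 0\<bar> \<le> \<tau>' * \<delta>}"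
    note D0 = shear_box2[of "\<tau> * \<delta> ^ k / 2" "\<tau>' * \<delta>" "\<tau> * \<delta> ^ k" l 0, folded D0_def]
    have \<delta>k: "0 < \<delta> ^ k" "\<delta> \<le> \<delta> ^ k" "\<delta> ^ k \<le> 1"
      using \<delta> k power_decreasing[of k 1 \<delta>] by (auto simp: power_le_one)
    have bounds: "x \<in> D \<and> \<bar>x $ 1\<bar> \<le> \<delta> ^ k \<and> \<bar>x $ 2 - l * x $ 1\<bar> \<le> \<delta>" if "x \<in> D0" for x
    proof -
      have x_D0: "\<bar>x $ 1 - \<tau> * \<delta> ^ k\<bar> \<le> \<tau> * \<delta> ^ k / 2" and x2: "\<bar>x $ 2 - l * x $ 1\<bar> \<le> \<tau>' * \<delta>"
        using that by (simp_all add: D0_def)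
      from x_D0 have "\<tau> * \<delta> ^ k / 2 \<le> x $ 1" "x $ 1 \<le> 3 / 2 * (\<tau> * \<delta> ^ k)" by linarith+
      moreover have "\<tau> * \<delta> ^ k \<le> \<tau> * 1" "\<tau> * \<delta> ^ k \<le> 1 / 4 * \<delta> ^ k"
        using \<tau> \<delta>k by (auto intro!: mult_left_mono mult_right_mono)
      moreover have "0 < \<tau> * \<delta> ^ k" using \<tau> \<delta>k by simp
      ultimately have x1: "0 < x $ 1" "x $ 1 < \<rho>" "\<bar>x $ 1\<bar> \<le> \<delta> ^ k" "\<tau> * \<delta> ^ k / 2 \<le> x $ 1"
        using \<tau> \<rho> by linarith+
      have "\<tau>' * \<delta> \<le> \<eta> * \<tau> / 4 * \<delta> ^ k" using \<tau>' \<delta>k \<delta> by (intro mult_mono) auto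
      also have "\<dots> < \<eta> * (\<tau> * \<delta> ^ k / 2)" using \<eta> \<tau> \<delta>k by simp
      also have "\<dots> \<le> \<eta> * x $ 1" using \<eta> x1 by (intro mult_left_mono) auto
      finally have "\<tau>' * \<delta> < \<eta> * x $ 1" .
      moreover have "\<tau>' * \<delta> \<le> 1 * \<delta>" using \<tau>' \<delta> by (intro mult_right_mono) auto
      ultimately show ?thesis using x1 x2 by (auto intro!: cone)
    qed
    show ?thesis
    proof (rule captures_areaI[OF t(1,2)])
      show "D0 \<in> sets borel" "D0 \<subseteq> D" using bounds D0 \<delta> \<tau> \<tau>' by auto
      show "ennreal (\<tau> * \<tau>' * 2 * \<delta> powr real (k + 1)) \<le> emeasure lborel D0"
        using D0 \<delta> \<tau> \<tau>' unfolding powr[OF \<delta>(1)] by (simp add: mult_ac)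
      fix x assume "x \<in> D0"
      note x = bounds[OF this]
      have t_bd: "\<bar>t * b\<bar> \<le> 2 * a" if "\<bar>b\<bar> \<le> a" for a b
        unfolding abs_mult using that t by (intro mult_mono) auto
      have "\<bar>y $ 1 - t * x $ 1\<bar> \<le> 3 * \<delta> ^ k" using t_bd[of "x $ 1" "\<delta> ^ k"] x y by linarith
      moreover have "(y $ 2 - t * x $ 2) - l * (y $ 1 - t * x $ 1) = (y $ 2 - l * y $ 1) - t * (x $ 2 - l * x $ 1)"
        by (simp add: algebra_simps)
      then have "\<bar>(y $ 2 - t * x $ 2) - l * (y $ 1 - t * x $ 1)\<bar> \<le> 3 * \<delta>"
        using t_bd[of "x $ 2 - l * x $ 1" \<delta>] x y by linarith
      moreover have "y $ 3 - t * (\<Phi> x + c) = (y $ 3 - t * c) - t * \<Phi> x" by (simp add: algebra_simps)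
      then have "\<bar>y $ 3 - t * (\<Phi> x + c)\<bar> \<le> \<delta> ^ N + 2 * (B * \<delta> ^ N)"
        using t_bd[OF small[OF \<delta>, of x]] x t(3) by linarith
      ultimately show "y - t *\<^sub>R vector [x $ 1, x $ 2, \<Phi> x + c] \<in> E \<delta>"
        by (simp add: E_def algebra_simps)
    qed
  qed
  have pos: "(0::real) < 1" "0 < \<tau> * \<tau>' * 2" "0 < 72 * (2 * B + 1)" using \<tau> \<tau>' B by auto
  show "real (k + 1 + N) * recip p \<le> real (k + 1) + real (k + 1 + N) * recip q" if c: "c = 0"
  proof (rule test_family_exponents[OF poly D_borel D_bounded p q bdd pos(1,2) _ pos(3), where E = E and F = "\<lambda>\<delta>. F 0 (\<delta> ^ N) \<delta>"])
    show "(0::real) < 8" by simp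
    fix \<delta> :: real assume \<delta>: "0 < \<delta>" "\<delta> < 1"
    show "F 0 (\<delta> ^ N) \<delta> \<in> sets borel \<and> ennreal (8 * \<delta> powr real (k + 1 + N)) \<le> emeasure lborel (F 0 (\<delta> ^ N) \<delta>)"
      using \<delta> unfolding powr[OF \<delta>(1)] by (simp add: F power_add mult_ac)
    fix y assume "y \<in> F 0 (\<delta> ^ N) \<delta>"
    then show "captures_area \<Phi> c D (E \<delta>) (\<tau> * \<tau>' * 2 * \<delta> powr real (k + 1)) y"
      using \<delta> c by (intro captures[of \<delta> y 1]) (auto simp: F_def)
  qed (use E in auto)
  show "real (k + 1 + N) * recip p \<le> real (k + 1) + real (k + 1) * recip q" if c: "c \<noteq> 0"
  proof (rule test_family_exponents[OF poly D_borel D_bounded p q bdd pos(1,2) _ pos(3), where E = E and F = "\<lambda>\<delta>. F (3 / 2 * c) (\<bar>c\<bar> / 2) \<delta>"])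
    show "0 < 4 * \<bar>c\<bar>" using c by simp
    fix \<delta> :: real assume \<delta>: "0 < \<delta>" "\<delta> < 1"
    show "F (3 / 2 * c) (\<bar>c\<bar> / 2) \<delta> \<in> sets borel \<and>
        ennreal (4 * \<bar>c\<bar> * \<delta> powr real (k + 1)) \<le> emeasure lborel (F (3 / 2 * c) (\<bar>c\<bar> / 2) \<delta>)"
      using \<delta> unfolding powr[OF \<delta>(1)] by (simp add: F mult_ac)
    fix y assume y: "y \<in> F (3 / 2 * c) (\<bar>c\<bar> / 2) \<delta>"
    then have "\<bar>y $ 3 - 3 / 2 * c\<bar> \<le> \<bar>c\<bar> / 2" by (simp add: F_def)
    then have "1 \<le> y $ 3 / c" "y $ 3 / c \<le> 2"
      using c by (auto simp: le_divide_eq divide_le_eq abs_if split: if_splits)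
    with y show "captures_area \<Phi> c D (E \<delta>) (\<tau> * \<tau>' * 2 * \<delta> powr real (k + 1)) y"
      using \<delta> c by (intro captures[of \<delta> y "y $ 3 / c"]) (auto simp: F_def)
  qed (use E in auto)
qed

end

section \<open>Sectors and the quadrilateral\<close>

lemma angle_scale:
  assumes "0 < s"
  shows "angle (s *\<^sub>R x) v = angle x v"
  using assms by (simp add: angle_def)

lemma sector_scale: "0 < s \<Longrightarrow> x \<in> sector \<epsilon> v \<Longrightarrow> s *\<^sub>R x \<in> sector \<epsilon> v"
  by (simp add: sector_def angle_scale)

lemma open_sector: "open (sector \<epsilon> v)"
proof (cases "v = 0")
  case True
  then show ?thesis by (cases "arccos 0 < \<epsilon>") (auto simp: sector_def angle_def intro!: open_Collect_neq continuous_intros)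
next
  case False
  have cont: "continuous_on (- {0}) (\<lambda>x. angle x w)" if "w \<noteq> 0" for w
    unfolding angle_def
  proof (intro continuous_on_arccos ballI)
    show "continuous_on (- {0}) (\<lambda>x. x \<bullet> w / (norm x * norm w))"
      using that by (intro continuous_intros) auto
    fix x :: "real^2" assume "x \<in> - {0}"
    then have "0 < norm x * norm w" using that by simp
    then show "- 1 \<le> x \<bullet> w / (norm x * norm w) \<and> x \<bullet> w / (norm x * norm w) \<le> 1"
      using Cauchy_Schwarz_ineq2[of x w] by (simp add: field_simps abs_le_iff)
  qed
  let ?S = "\<lambda>w. - {0} \<inter> (\<lambda>x. angle x w) -` {..<\<epsilon>}"
  have "open (?S w)" if "w \<noteq> 0" for w
    using cont[OF that] by (rule continuous_open_preimage) auto
  then have "open (?S v \<union> ?S (- v))" using False by (intro open_Un) auto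
  moreover have "sector \<epsilon> v = ?S v \<union> ?S (- v)" by (auto simp: sector_def)
  ultimately show ?thesis by simp
qed

text \<open>The sector is open, contains \<open>(1, l)\<close>, and is invariant under positive scaling.\<close>

lemma Gamma_sector_contains_cone:
  assumes "0 < \<epsilon>"
  obtains \<eta> where "0 < \<eta>"
    "\<And>x. 0 < x $ 1 \<Longrightarrow> \<bar>x $ 2 - l * x $ 1\<bar> < \<eta> * x $ 1 \<Longrightarrow> x \<in> Gamma_sector \<epsilon> l"
proof -
  let ?v = "vector [1, l] :: real^2"
  have v: "?v \<noteq> 0" by (simp add: vec_eq_iff forall_2)
  then have "angle ?v ?v = 0"
    by (simp add: angle_def dot_square_norm power2_eq_square)
  then have "?v \<in> Gamma_sector \<epsilon> l" using v assms by (simp add: Gamma_sector_def sector_def)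
  then obtain \<eta> where \<eta>: "0 < \<eta>" "ball ?v \<eta> \<subseteq> Gamma_sector \<epsilon> l"
    using open_sector[of \<epsilon> ?v] open_contains_ball by (metis Gamma_sector_def)
  show ?thesis
  proof (rule that[OF \<eta>(1)])
    fix x :: "real^2" assume x: "0 < x $ 1" "\<bar>x $ 2 - l * x $ 1\<bar> < \<eta> * x $ 1"
    let ?y = "(1 / x $ 1) *\<^sub>R x"
    have "norm (?y - ?v) \<le> \<bar>x $ 2 / x $ 1 - l\<bar>"
      using norm_le_components2[of "?y - ?v"] x by simp
    also have "\<dots> = \<bar>x $ 2 - l * x $ 1\<bar> / x $ 1"
      using x by (simp add: abs_div_pos diff_divide_distrib)
    also have "\<dots> < \<eta>" using x by (simp add: divide_less_eq)
    finally have "?y \<in> Gamma_sector \<epsilon> l" using \<eta>(2) by (auto simp: dist_norm norm_minus_commute)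
    then have "x $ 1 *\<^sub>R ?y \<in> Gamma_sector \<epsilon> l"
      using sector_scale[OF x(1)] by (simp only: Gamma_sector_def)
    then show "x \<in> Gamma_sector \<epsilon> l" using x by simp
  qed
qed

text \<open>The diagonal from the origin to \<open>(2/3, 1/3)\<close>, of slope \<open>1/2\<close>, cuts the quadrilateral into two
triangles, and in each of them the convex coefficients are explicit. A convex set with interior
points has the same closure as its interior.\<close>

lemma closure_Delta0I:
  assumes "b \<le> a" "3 * a \<le> 2" "2 * a \<le> 1 + b" "a \<le> 3 * b"
  shows "(a, b) \<in> closure Delta0"
proof -
  define Q :: "(real \<times> real) set"
    where "Q = convex hull {(0, 0), (2/3, 2/3), (2/3, 1/3), (3/5, 1/5)}"
  have comb: "(u * (2/3) + v * (2/3) + w * (3/5), u * (2/3) + v * (1/3) + w * (1/5)) \<in> Q"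
    if "0 \<le> u" "0 \<le> v" "0 \<le> w" "u + v + w \<le> 1" for u v w :: real
  proof -
    define V :: "nat \<Rightarrow> real \<times> real" where
      "V = (\<lambda>j. if j = 0 then (0, 0) else if j = 1 then (2/3, 2/3) else if j = 2 then (2/3, 1/3) else (3/5, 1/5))"
    define k where "k = (\<lambda>j::nat. if j = 0 then 1 - u - v - w else if j = 1 then u else if j = 2 then v else w)"
    have "(\<Sum>j\<in>{0, 1, 2, 3}. k j *\<^sub>R V j) \<in> Q"
    proof (rule convex_sum)
      show "V j \<in> Q" for j
        unfolding Q_def V_def by (intro hull_inc) auto
    qed (use that in \<open>auto simp: k_def Q_def convex_convex_hull\<close>)
    then show ?thesis by (simp add: k_def V_def add.assoc)
  qed
  have Q: "(a, b) \<in> Q" if "b \<le> a" "3 * a \<le> 2" "2 * a \<le> 1 + b" "a \<le> 3 * b" for a b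
  proof (cases "a \<le> 2 * b")
    case True
    then show ?thesis using comb[of "3 * b - 3 / 2 * a" "3 * a - 3 * b" 0] that by (simp add: algebra_simps)
  next
    case False
    then show ?thesis using comb[of 0 "9 * b - 3 * a" "5 * a - 10 * b"] that by (simp add: algebra_simps)
  qed
  define O' where "O' = {z :: real \<times> real. snd z < fst z \<and> 3 * fst z < 2 \<and> 2 * fst z < 1 + snd z \<and> fst z < 3 * snd z}"
  have "open O'" unfolding O'_def by (intro open_Collect_conj open_Collect_less continuous_intros)
  moreover have "O' \<subseteq> Q" using Q by (auto simp: O'_def)
  moreover have "(1/2, 1/3) \<in> O'" by (simp add: O'_def)
  ultimately have "interior Q \<noteq> {}" by (metis interior_maximal subsetD empty_iff)
  then have "closure (interior Q) = closure Q"
    by (intro convex_closure_interior) (auto simp: Q_def convex_convex_hull)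
  moreover have "interior Q \<subseteq> Delta0" by (auto simp: Delta0_def Q_def)
  ultimately show ?thesis using Q[OF assms] closure_mono closure_subset by blast
qed

section \<open>Sectors around a line of zeros\<close>

text \<open>The ray required by the locale is taken close to the line of slope \<open>l\<close> but not on it: the cofactor
\<open>P\<close> is nonzero at \<open>(1, l)\<close>, hence \<open>\<Phi> \<noteq> 0\<close> at \<open>(1, l + s)\<close> for small \<open>s > 0\<close>. The two flatness
estimates are \<open>\<bar>\<Phi>\<bar> \<le> B1 \<delta>\<^sup>n\<close> from the factorisation and \<open>\<bar>\<Phi>\<bar> \<le> B2 \<delta>\<^sup>m\<close> from homogeneity.\<close>

lemma cone_conditions:
  fixes \<Phi> :: "real^2 \<Rightarrow> real" and c l :: real and m n :: nat and U :: "(real^2) set" and p q :: ennreal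
  assumes m: "2 \<le> m" and hom: "homogeneous_poly m \<Phi>" and \<epsilon>: "0 < \<epsilon>"
    and U: "open U" "0 \<in> U" "U \<subseteq> ball 0 1"
    and order: "vanishing_order \<Phi> l n"
    and pq: "1 \<le> p" "1 \<le> q"
    and bdd: "maximal_bounded (graph_measure \<Phi> c (Gamma_sector \<epsilon> l \<inter> U)) p q"
  defines "a \<equiv> recip p" and "b \<equiv> recip q" and "h \<equiv> max (real m / 2) (real n)"
  shows "(a, b) \<in> closure Delta0" "c = 0 \<Longrightarrow> (h + 1) * a - (h + 1) * b - 1 \<le> 0"
    "c \<noteq> 0 \<Longrightarrow> (h + 1) * a - b - 1 \<le> 0"
proof -
  note poly = homogeneous_poly_polynomial[OF hom]
  note scale = homogeneous_poly_scale[OF hom]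
  let ?D = "Gamma_sector \<epsilon> l \<inter> U"
  obtain \<eta> where \<eta>: "0 < \<eta>"
    "\<And>x. 0 < x $ 1 \<Longrightarrow> \<bar>x $ 2 - l * x $ 1\<bar> < \<eta> * x $ 1 \<Longrightarrow> x \<in> Gamma_sector \<epsilon> l"
    using Gamma_sector_contains_cone[OF \<epsilon>] by blast
  obtain u where u: "0 < u" "ball 0 u \<subseteq> U" using U open_contains_ball by blast
  \<comment> \<open>the cone truncated at \<open>x\<^sub>1 < \<rho>\<close> stays inside the ball of radius \<open>u\<close>\<close>
  define \<rho> where "\<rho> = u / (1 + \<bar>l\<bar> + \<eta>)"
  have \<rho>: "0 < \<rho>" using u \<eta> by (simp add: \<rho>_def add_pos_nonneg add_nonneg_pos)
  have cone: "x \<in> ?D" if x: "0 < x $ 1" "x $ 1 < \<rho>" "\<bar>x $ 2 - l * x $ 1\<bar> < \<eta> * x $ 1" for x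
  proof -
    have "\<bar>x $ 2\<bar> \<le> \<bar>x $ 2 - l * x $ 1\<bar> + \<bar>l * x $ 1\<bar>" by linarith
    then have "norm x \<le> \<bar>x $ 1\<bar> + (\<eta> * x $ 1 + \<bar>l\<bar> * x $ 1)"
      using norm_le_components2[of x] x by (simp add: abs_mult)
    also have "\<dots> = (1 + \<bar>l\<bar> + \<eta>) * x $ 1" using x by (simp add: algebra_simps)
    also have "\<dots> < (1 + \<bar>l\<bar> + \<eta>) * \<rho>" using x \<eta> by (intro mult_strict_left_mono) auto
    also have "\<dots> = u" using \<eta> by (simp add: \<rho>_def)
    finally show ?thesis using \<eta>(2)[OF x(1,3)] u by auto
  qed
  obtain P where P: "real_polynomial_function P" "\<And>x. \<Phi> x = (x $ 2 - l * x $ 1) ^ n * P x"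
    "\<And>x. x \<in> line l - {0} \<Longrightarrow> P x \<noteq> 0"
    using order unfolding vanishing_order_def by blast
  let ?v0 = "vector [1, l] :: real^2"
  have "P ?v0 \<noteq> 0" by (intro P) (auto simp: line_def vec_eq_iff forall_2)
  moreover have "continuous (at ?v0) P"
    using polynomial_continuous_on[OF P(1), of UNIV] by (simp add: continuous_on_eq_continuous_at)
  ultimately obtain e where e: "0 < e" "\<And>x. dist ?v0 x < e \<Longrightarrow> P x \<noteq> 0"
    using continuous_at_avoid by metis
  define s where "s = min \<eta> e / 2"
  define v where "v = (vector [1, l + s] :: real^2)"
  have s: "0 < s" "s < \<eta>" "s < e" using e \<eta> by (auto simp: s_def)
  have "norm (v - ?v0) \<le> s" using norm_le_components2[of "v - ?v0"] s by (simp add: v_def)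
  then have "P v \<noteq> 0" using s by (intro e) (simp add: dist_norm norm_minus_commute)
  then have \<Phi>v: "\<Phi> v \<noteq> 0" using s P(2)[of v] by (simp add: v_def)
  interpret surface_patch \<Phi> m ?D v c \<rho>
  proof
    show "open ?D" using U open_sector by (auto simp: Gamma_sector_def)
    show "w *\<^sub>R v \<in> ?D" if "0 < w" "w < \<rho>" for w
    proof (rule cone)
      have "(w *\<^sub>R v) $ 2 - l * (w *\<^sub>R v) $ 1 = s * w" by (simp add: v_def algebra_simps)
      then show "\<bar>(w *\<^sub>R v) $ 2 - l * (w *\<^sub>R v) $ 1\<bar> < \<eta> * (w *\<^sub>R v) $ 1"
        using s that by (simp add: v_def)
    qed (use that in \<open>simp_all add: v_def\<close>)
  qed (use poly scale m U \<rho> \<Phi>v in auto)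
  show "(a, b) \<in> closure Delta0"
    unfolding a_def b_def
    using large_ball_condition[OF pq bdd] small_ball_condition[OF pq bdd]
      Knapp_condition[OF pq bdd] graph_condition[OF pq bdd]
    by (intro closure_Delta0I) auto
  have x2: "norm x \<le> 2 + \<bar>l\<bar>" if "\<bar>x $ 1\<bar> \<le> 1" "\<bar>x $ 2 - l * x $ 1\<bar> \<le> 1" for x :: "real^2"
  proof -
    have "\<bar>l * x $ 1\<bar> \<le> \<bar>l\<bar>" using mult_left_mono[OF that(1), of "\<bar>l\<bar>"] by (simp add: abs_mult)
    then show ?thesis using that norm_le_components2[of x] by linarith
  qed
  obtain B1 where B1: "0 < B1" "\<And>x. norm x \<le> 2 + \<bar>l\<bar> \<Longrightarrow> \<bar>P x\<bar> \<le> B1"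
    using polynomial_bounded[OF P(1)] by metis
  obtain B2 where B2: "0 < B2" "\<And>x. norm x \<le> 2 + \<bar>l\<bar> \<Longrightarrow> \<bar>\<Phi> x\<bar> \<le> B2"
    using polynomial_bounded[OF poly] by metis
  have near_line: "\<bar>\<Phi> x\<bar> \<le> B1 * \<delta> ^ n"
    if "0 < \<delta>" "\<delta> < 1" "\<bar>x $ 1\<bar> \<le> 1" "\<bar>x $ 2 - l * x $ 1\<bar> \<le> \<delta>" for x \<delta>
  proof -
    have "\<bar>\<Phi> x\<bar> = \<bar>P x\<bar> * \<bar>x $ 2 - l * x $ 1\<bar> ^ n" by (simp add: P(2) abs_mult power_abs mult.commute)
    also have "\<dots> \<le> B1 * \<delta> ^ n" using that B1 x2[of x] by (intro mult_mono power_mono) auto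
    finally show ?thesis .
  qed
  have near_origin: "\<bar>\<Phi> x\<bar> \<le> B2 * \<delta> ^ m"
    if "0 < \<delta>" "\<delta> < 1" "\<bar>x $ 1\<bar> \<le> \<delta>" "\<bar>x $ 2 - l * x $ 1\<bar> \<le> \<delta>" for x \<delta>
  proof -
    let ?x = "(1 / \<delta>) *\<^sub>R x"
    have "?x $ 2 - l * ?x $ 1 = (x $ 2 - l * x $ 1) / \<delta>" by (simp add: diff_divide_distrib)
    then have "norm ?x \<le> 2 + \<bar>l\<bar>" using that by (intro x2) (simp_all add: abs_div_pos[symmetric] del: diff_divide_distrib)
    then have "\<delta> ^ m * \<bar>\<Phi> ?x\<bar> \<le> \<delta> ^ m * B2" using that B2(2) by (intro mult_left_mono) auto
    moreover have "\<Phi> x = \<delta> ^ m * \<Phi> ?x" using scale[of \<delta> ?x] that by simp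
    ultimately show ?thesis using that by (simp add: abs_mult mult.commute)
  qed
  note line_conditions = anisotropic_condition[OF pq bdd \<eta>(1), where k = 0 and N = n and l = l and B = B1]
  note origin_conditions = anisotropic_condition[OF pq bdd \<eta>(1), where k = 1 and N = m and l = l and B = B2]
  show "(h + 1) * a - (h + 1) * b - 1 \<le> 0" if "c = 0"
  proof -
    have "real (0 + 1 + n) * a \<le> real (0 + 1) + real (0 + 1 + n) * b"
      unfolding a_def b_def
      by (rule line_conditions(1)) (use that B1 in \<open>auto intro: cone[THEN IntD1] cone[THEN IntD2] near_line\<close>)
    moreover have "real (1 + 1 + m) * a \<le> real (1 + 1) + real (1 + 1 + m) * b"
      unfolding a_def b_def
      by (rule origin_conditions(1)) (use that B2 in \<open>auto intro: cone[THEN IntD1] cone[THEN IntD2] near_origin\<close>)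
    ultimately show ?thesis by (simp add: h_def max_def algebra_simps)
  qed
  show "(h + 1) * a - b - 1 \<le> 0" if "c \<noteq> 0"
  proof -
    have "real (0 + 1 + n) * a \<le> real (0 + 1) + real (0 + 1) * b"
      unfolding a_def b_def
      by (rule line_conditions(2)) (use that B1 in \<open>auto intro: cone[THEN IntD1] cone[THEN IntD2] near_line\<close>)
    moreover have "real (1 + 1 + m) * a \<le> real (1 + 1) + real (1 + 1) * b"
      unfolding a_def b_def
      by (rule origin_conditions(2)) (use that B2 in \<open>auto intro: cone[THEN IntD1] cone[THEN IntD2] near_origin\<close>)
    ultimately show ?thesis by (simp add: h_def max_def algebra_simps)
  qed
qed

theorem theorem1p3:
  fixes m :: nat and c :: real and \<Phi> :: "real^2 \<Rightarrow> real"
    and c\<Phi> :: complex and \<nu>1 \<nu>2 N :: nat and \<mu> :: "nat \<Rightarrow> complex" and n :: "nat \<Rightarrow> nat"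
  assumes "2 \<le> m"
    and "homogeneous_poly m \<Phi>"
    and "\<exists>x. \<Phi> x \<noteq> 0"
    and "\<forall>x. complex_of_real (\<Phi> x) =
           c\<Phi> * complex_of_real (x $ 1) ^ \<nu>1 * complex_of_real (x $ 2) ^ \<nu>2 *
           (\<Prod>h=1..N. (complex_of_real (x $ 2) - \<mu> h * complex_of_real (x $ 1)) ^ n h)"
    and "inj_on \<mu> {1..N}"
    and "\<forall>h\<in>{1..N}. \<mu> h \<noteq> 0"
    and "\<nu>1 + \<nu>2 + (\<Sum>h=1..N. n h) = m"
    and "\<nu>1 < m" and "\<nu>2 < m" and "\<forall>h\<in>{1..N}. n h < m"
  shows "\<exists>\<epsilon>0>0. \<forall>\<epsilon>. 0 < \<epsilon> \<and> \<epsilon> < \<epsilon>0 \<and> sectors_disjoint \<Phi> \<epsilon> \<longrightarrow>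
    (\<exists>r>0. \<forall>U. open U \<and> 0 \<in> U \<and> U \<subseteq> ball 0 r \<longrightarrow>
      (\<forall>l \<in> hessian_slopes \<Phi>. \<forall>nl. type_A \<Phi> l \<and> vanishing_order \<Phi> l nl \<longrightarrow>
        (let hl = max (real m / 2) (real nl) in
          \<forall>p q :: ennreal. 1 \<le> p \<and> 1 \<le> q \<and>
            maximal_bounded (graph_measure \<Phi> c (Gamma_sector \<epsilon> l \<inter> U)) p q \<longrightarrow>
              (recip p, recip q) \<in> closure Delta0 \<and>
              (c = 0 \<longrightarrow> (hl + 1) * recip p - (hl + 1) * recip q - 1 \<le> 0) \<and>
              (c \<noteq> 0 \<longrightarrow> (hl + 1) * recip p - recip q - 1 \<le> 0))))"
proof (rule exI[of _ 1], intro conjI allI impI)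
  fix \<epsilon> :: real assume "0 < \<epsilon> \<and> \<epsilon> < 1 \<and> sectors_disjoint \<Phi> \<epsilon>"
  then have \<epsilon>: "0 < \<epsilon>" by simp
  show "\<exists>r>0. \<forall>U. open U \<and> 0 \<in> U \<and> U \<subseteq> ball 0 r \<longrightarrow>
      (\<forall>l \<in> hessian_slopes \<Phi>. \<forall>nl. type_A \<Phi> l \<and> vanishing_order \<Phi> l nl \<longrightarrow>
        (let hl = max (real m / 2) (real nl) in
          \<forall>p q :: ennreal. 1 \<le> p \<and> 1 \<le> q \<and>
            maximal_bounded (graph_measure \<Phi> c (Gamma_sector \<epsilon> l \<inter> U)) p q \<longrightarrow>
              (recip p, recip q) \<in> closure Delta0 \<and>
              (c = 0 \<longrightarrow> (hl + 1) * recip p - (hl + 1) * recip q - 1 \<le> 0) \<and>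
              (c \<noteq> 0 \<longrightarrow> (hl + 1) * recip p - recip q - 1 \<le> 0)))"
    unfolding Let_def
    by (rule exI[of _ 1]) (use cone_conditions[OF assms(1,2) \<epsilon>] in \<open>intro conjI allI ballI impI; auto\<close>)
qed simp

end
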